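(* Let $\alpha\in(0,1)$, let $h$ be a continuous function on $\mathbb{R}$ in the Wiener amalgam space $\mathcal{W}_1$, let $I$ be the identity operator on $L^p$, and let $T$ be an integral operator $$Tf(x):=\int_{\mathbb{R}}K_T(x,y)f(y)\,dy,\qquad f\in L^p,$$ whose integral kernel $K_T$ satisfies $$|K_T(x,y)|\le h(x-y)\quad\text{for all }x,y\in\mathbb{R},$$ and $$|\omega_\delta(K_T)(x,y)|\le\delta^\alpha h(x-y)\quad\text{for all }x,y\in\mathbb{R}\text{ and }\delta\in(0,1).$$ If $I+T$ has $L^p$-stability for some $1\le p\le\infty$, then $I+T$ has $L^q$-stability for all $1\le q\le\infty$.
   Context: $L^p=L^p(\mathbb{R})$ with standard norm $\|\cdot\|_p$. The Wiener amalgam space is $\mathcal{W}_1=\{\phi:\ \|\phi\|_{\mathcal{W}_1}:=\sum_{k\in\mathbb{Z}}\sup_{x\in[0,1)}|\phi(k+x)|<\infty\}$. The modulus of continuity of a function $K$ of two variables is $\omega_\delta(K)(x,y)=\sup_{|(x',y')|\le\delta}|K(x+x',y+y')-K(x,y)|$, where $|\cdot|$ is the Euclidean norm on $\mathbb{R}^2$. A bounded operator $S$ on $L^p$ has $L^p$-stability if there exists a positive constant $C$ such that $C^{-1}\|f\|_p\le\|Sf\|_p\le C\|f\|_p$ for all $f\in L^p$. *)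

theory Defs
  imports "HOL-Probability.Essential_Supremum"
begin

text \<open>
  Elements of $L^p(\mathbb{R})$ are represented by complex-valued Lebesgue measurable functions,
  not by classes modulo equality almost everywhere. The exponent is an extended nonnegative real;
  only \<open>1 \<le> p\<close> is used.
\<close>

definition Lp :: "ennreal \<Rightarrow> (real \<Rightarrow> complex) set" where
  "Lp p = {f \<in> borel_measurable lebesgue.
     if p = \<infinity> then esssup lebesgue (\<lambda>x. ennreal (cmod (f x))) < \<infinity>
     else integrable lebesgue (\<lambda>x. cmod (f x) powr enn2real p)}"

definition Lp_norm :: "ennreal \<Rightarrow> (real \<Rightarrow> complex) \<Rightarrow> real" where
  "Lp_norm p f =
     (if p = \<infinity> then enn2real (esssup lebesgue (\<lambda>x. ennreal (cmod (f x))))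
      else (LINT x|lebesgue. cmod (f x) powr enn2real p) powr (1 / enn2real p))"

text \<open>
  Linearity is required almost everywhere, since equality in $L^p$ is equality almost everywhere.
  Together with boundedness it makes \<open>S\<close> compatible with that equality.
\<close>

definition bounded_op_Lp ::
  "ennreal \<Rightarrow> ((real \<Rightarrow> complex) \<Rightarrow> (real \<Rightarrow> complex)) \<Rightarrow> bool" where
  "bounded_op_Lp p S \<longleftrightarrow>
     (\<forall>f\<in>Lp p. S f \<in> Lp p) \<and>
     (\<forall>f\<in>Lp p. \<forall>g\<in>Lp p. \<forall>a b.
        AE x in lebesgue. S (\<lambda>y. a * f y + b * g y) x = a * S f x + b * S g x) \<and>
     (\<exists>B. \<forall>f\<in>Lp p. Lp_norm p (S f) \<le> B * Lp_norm p f)"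

definition Lp_stability ::
  "ennreal \<Rightarrow> ((real \<Rightarrow> complex) \<Rightarrow> (real \<Rightarrow> complex)) \<Rightarrow> bool" where
  "Lp_stability p S \<longleftrightarrow>
     bounded_op_Lp p S \<and>
     (\<exists>C>0. \<forall>f\<in>Lp p.
        inverse C * Lp_norm p f \<le> Lp_norm p (S f) \<and> Lp_norm p (S f) \<le> C * Lp_norm p f)"

definition wiener_norm :: "(real \<Rightarrow> real) \<Rightarrow> ennreal" where
  "wiener_norm \<phi> =
     (\<Sum>\<^sub>\<infinity>k\<in>(UNIV :: int set). SUP x\<in>{0..<1}. ennreal \<bar>\<phi> (real_of_int k + x)\<bar>)"

definition wiener_amalgam :: "(real \<Rightarrow> real) set" where
  "wiener_amalgam = {\<phi>. wiener_norm \<phi> < \<infinity>}"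

text \<open>The norm on \<open>real \<times> real\<close> is the Euclidean one. The modulus of continuity is
  extended-real valued so that the supremum exists without a boundedness assumption.\<close>

definition modulus_cont :: "real \<Rightarrow> (real \<Rightarrow> real \<Rightarrow> complex) \<Rightarrow> real \<Rightarrow> real \<Rightarrow> ereal" where
  "modulus_cont \<delta> K x y =
     (SUP (x', y')\<in>{z. norm z \<le> \<delta>}. ereal (cmod (K (x + x') (y + y') - K x y)))"

definition integral_op ::
  "(real \<Rightarrow> real \<Rightarrow> complex) \<Rightarrow> (real \<Rightarrow> complex) \<Rightarrow> (real \<Rightarrow> complex)" where
  "integral_op K f x = (LINT y|lebesgue. K x y * f y)"

end

theory Submission
  imports Defs
begin

text \<open>
  Write \<open>g = f + T f\<close> and \<open>u = T f\<close>. Since \<open>u + T u = T g\<close> and \<open>T\<close> maps local $L^1$ norms to local sup norms,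
  it is enough to control the local $L^p$ norms of \<open>u\<close> by those of \<open>T g\<close>. Cut the line into blocks of
  length \<open>N\<close> and apply the $L^p$-stability to \<open>\<psi>\<^sub>n u\<close>, where \<open>\<psi>\<^sub>n\<close> is a Lipschitz cutoff around the \<open>n\<close>th block. The
  commutator of \<open>T\<close> and \<open>\<psi>\<^sub>n\<close> is dominated by a convolution over blocks whose total mass tends to 0 as
  \<open>N\<close> grows, so for large \<open>N\<close> a Neumann series on the integers bounds the block norms of \<open>u\<close> by a
  summable convolution with those of \<open>T g\<close>. Altogether \<open>\<bar>u x\<bar> \<le> \<integral> W x y * \<bar>g y\<bar> \<partial>y\<close> with a
  kernel \<open>W\<close> that does not depend on \<open>f\<close>, and Schur's test applies to it for every exponent.
\<close>

section \<open>Modulars and Schur tests\<close>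

text \<open>The obstacle is that \<open>f\<close> in L^q need not lie locally in L^p, so stability
  at \<open>p\<close> says nothing about cutoffs of \<open>f\<close>. But \<open>T f\<close> is
  bounded for every \<open>q\<close>, so its cutoffs lie in every L^p; this is why the estimate runs
  through \<open>u\<close> and returns to \<open>f\<close> only by \<open>f = g - T f\<close>. The
  bound on \<open>u\<close> depends on \<open>f\<close>, but it is purely qualitative: it lets
  integrals split and makes the Neumann remainder vanish, and it enters no constant. The gain for
  large \<open>N\<close> comes from the Lipschitz constant 1/N of the cutoffs. The commutator has
  the kernel (psi_n(y) - psi_n(x)) K(x,y), which is at most min(1, |x-y|/N) |h(x-y)|, and the
  integral of this majorant tends to 0. A bound for each pair of blocks would not do: it must be
  summable over the distance of the blocks, which is where the supports of the cutoffs enter. The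
  modulus of continuity makes \<open>K\<close> jointly continuous, hence Borel, as Tonelli's theorem
  requires. Luxemburg bounds have to be strictly positive; this explains the small \<open>e\<close>
  and the added 1 in many bounds.\<close>

text \<open>
  The $L^q$ norms are handled as Luxemburg norms: the norm of \<open>f\<close> is at most \<open>c\<close> iff the integral of
  \<open>modular q (f / c)\<close> is at most 1. This makes \<open>q = \<infinity>\<close> an instance of the same convexity arguments.
\<close>

definition modular :: "ennreal \<Rightarrow> ennreal \<Rightarrow> ennreal" where
  "modular q t =
     (if q = \<infinity> then (if t \<le> 1 then 0 else \<infinity>)
      else if t = \<infinity> then \<infinity> else ennreal (enn2real t powr enn2real q))"

lemma measurable_modular [measurable]: "modular q \<in> borel_measurable borel"
  unfolding modular_def by measurable

lemma modular_0 [simp]: "modular q 0 = 0"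
  by (simp add: modular_def)

lemma one_le_enn2real: "1 \<le> enn2real q" if "1 \<le> q" "q \<noteq> \<infinity>"
  using that by (cases q) (auto simp: ennreal_le_iff2 simp flip: ennreal_1)

lemma modular_mono: "s \<le> t \<Longrightarrow> modular q s \<le> modular q t"
proof (cases "q = \<infinity> \<or> t = \<infinity>")
  case False
  assume "s \<le> t"
  with False have "s \<noteq> \<infinity>" "enn2real s \<le> enn2real t"
    by (auto simp: top_unique less_top[symmetric] intro!: enn2real_mono)
  with False show ?thesis
    by (auto simp: modular_def intro!: ennreal_leI powr_mono2)
qed (auto simp: modular_def top_unique)

text \<open>By convexity the graph of t^r lies above its tangent at \<open>x\<close>; the terms are
  arranged so that no subtraction occurs. Young's inequality with the exponents r and r/(r-1) gives
  it directly.\<close>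

lemma tangent_powr:
  fixes r x t :: real
  assumes "1 \<le> r" "0 < x" "0 \<le> t"
  shows "r * x powr (r - 1) * t \<le> t powr r + (r - 1) * x powr r"
proof (cases "r = 1")
  case True
  then show ?thesis using assms by simp
next
  case False
  then have r: "1 < r" using assms by simp
  have "t * x powr (r - 1) \<le> t powr r / r + (x powr (r - 1)) powr (r / (r - 1)) / (r / (r - 1))"
    using r assms by (intro Youngs_inequality) (auto simp: field_simps)
  also have "(x powr (r - 1)) powr (r / (r - 1)) = x powr r"
    using r by (simp add: powr_powr)
  finally show ?thesis using r by (simp add: field_simps)
qed

text \<open>A convex lower semicontinuous function is the supremum of its affine minorants. The
  minorant here is \<open>a * t - b\<close>, with \<open>b\<close> moved to the other side because
  subtraction in \<open>ennreal\<close> truncates. Choosing \<open>y\<close> strictly below the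
  value also covers an infinite value of the modular.\<close>

lemma modular_support:
  assumes q: "1 \<le> q" and y: "y < modular q X"
  obtains a b where "b < \<infinity>" "y + b \<le> a * X" "\<And>t. a * t \<le> modular q t + b"
proof -
  have yfin: "y < \<infinity>" using y by (simp add: less_le_trans[OF _ top_greatest])
  consider (1) "X = \<infinity>" | (2) "X < \<infinity>" "q = \<infinity>" | (3) "X < \<infinity>" "q < \<infinity>"
    unfolding infinity_ennreal_def less_top[symmetric] by blast
  then show ?thesis
  proof cases
    case 1
    have "1 * t \<le> modular q t + 1" for t
    proof (cases "t \<le> 1")
      case False
      show ?thesis
      proof (cases "q = \<infinity> \<or> t = \<infinity>")
        case True with False show ?thesis by (auto simp: modular_def)
      next
        case F: False
        then obtain x where x: "t = ennreal x" "0 \<le> x" by (cases t) auto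
        then have "1 < x" using False by (simp add: ennreal_le_1 not_le)
        then have "x powr 1 \<le> x powr enn2real q"
          using one_le_enn2real[OF q] F by (intro powr_mono) auto
        then have "t \<le> modular q t"
          using F x \<open>1 < x\<close> by (auto simp: modular_def intro!: ennreal_leI)
        then show ?thesis by (simp add: add_increasing2)
      qed
    qed (simp add: add_increasing)
    then show ?thesis using 1 yfin by (intro that[of 1 1]) auto
  next
    case 2
    then have X1: "1 < X" using y by (auto simp: modular_def split: if_splits)
    obtain x where x: "X = ennreal x" "1 < x" 
      using 2 X1 by (cases X) (auto )
    obtain z where z: "y = ennreal z" "0 \<le> z" using yfin by (cases y) auto
    \<comment> \<open>The slope of the line through (1, 0) and (x, z): it is nonpositive on [0, 1],
      where the modular vanishes, and beyond 1 the modular is infinite.\<close>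
    define a where "a = z / (x - 1)"
    have a: "0 \<le> a" "z + a = a * x" using x z by (auto simp: a_def field_simps)
    show ?thesis
    proof (rule that[of "ennreal a" "ennreal a"])
      show "y + ennreal a \<le> ennreal a * X"
        using a x z by (simp flip: ennreal_plus ennreal_mult')
      show "ennreal a * t \<le> modular q t + ennreal a" for t
        using 2 mult_left_mono[of t 1 "ennreal a"] by (auto simp: modular_def)
    qed simp
  next
    case 3
    define r where "r = enn2real q"
    have r: "1 \<le> r" using one_le_enn2real[OF q] 3 by (auto simp: r_def)
    obtain x where x: "X = ennreal x" "0 \<le> x" using 3 by (cases X) auto
    have yx: "y < ennreal (x powr r)"
      using y x 3 by (simp add: modular_def r_def less_top[symmetric])
    then have x0: "0 < x" using x by (cases "x = 0") auto
    have *: "r * x powr (r - 1) * x = x powr r + (r - 1) * x powr r"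
      using x0 by (simp add: powr_diff field_simps)
    show ?thesis
    proof (rule that[of "ennreal ((r - 1) * x powr r)" "ennreal (r * x powr (r - 1))"])
      have "y + ennreal ((r - 1) * x powr r) \<le> ennreal (x powr r) + ennreal ((r - 1) * x powr r)"
        using yx by (intro add_right_mono) simp
      also have "\<dots> = ennreal (r * x powr (r - 1)) * X"
        using r x0 x * by (simp flip: ennreal_plus ennreal_mult')
      finally show "y + ennreal ((r - 1) * x powr r) \<le> ennreal (r * x powr (r - 1)) * X" .
      show "ennreal (r * x powr (r - 1)) * t \<le> modular q t + ennreal ((r - 1) * x powr r)" for t
      proof (cases t)
        case (real s)
        then have "ennreal (r * x powr (r - 1)) * t = ennreal (r * x powr (r - 1) * s)"
          using r by (simp add: ennreal_mult')
        also have "\<dots> \<le> ennreal (s powr r + (r - 1) * x powr r)"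
          using r x0 real by (intro ennreal_leI tangent_powr) auto
        also have "\<dots> = modular q t + ennreal ((r - 1) * x powr r)"
          using r real 3 by (auto simp: modular_def r_def)
        finally show ?thesis .
      qed (use 3 in \<open>simp add: modular_def top_unique\<close>)
    qed simp
  qed
qed

text \<open>Jensen's inequality for weights of mass at most 1: integrate the affine minorant that
  lies above \<open>y\<close> at the mean. Missing mass does no harm because \<open>b\<close> is
  nonnegative, and \<open>b < \<infinity>\<close> allows it to be cancelled.\<close>

lemma modular_nn_integral:
  assumes q: "1 \<le> q" and [measurable]: "w \<in> borel_measurable M" "f \<in> borel_measurable M"
    and w: "(\<integral>\<^sup>+x. w x \<partial>M) \<le> 1"
  shows "modular q (\<integral>\<^sup>+x. w x * f x \<partial>M) \<le> (\<integral>\<^sup>+x. w x * modular q (f x) \<partial>M)"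
proof (rule ccontr)
  assume "\<not> ?thesis"
  then have "(\<integral>\<^sup>+x. w x * modular q (f x) \<partial>M) < modular q (\<integral>\<^sup>+x. w x * f x \<partial>M)"
    by (simp add: not_le)
  from dense[OF this] obtain y where y: "(\<integral>\<^sup>+x. w x * modular q (f x) \<partial>M) < y" "y < modular q (\<integral>\<^sup>+x. w x * f x \<partial>M)"
    by blast
  obtain a b where ab: "b < \<infinity>" "y + b \<le> a * (\<integral>\<^sup>+x. w x * f x \<partial>M)" "\<And>t. a * t \<le> modular q t + b"
    using modular_support[OF q y(2)] by blast
  have "y + b \<le> (\<integral>\<^sup>+x. a * (w x * f x) \<partial>M)"
    using ab(2) by (simp add: nn_integral_cmult)
  also have "\<dots> \<le> (\<integral>\<^sup>+x. w x * modular q (f x) + b * w x \<partial>M)"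
  proof (rule nn_integral_mono)
    show "a * (w x * f x) \<le> w x * modular q (f x) + b * w x" for x
      using mult_left_mono[OF ab(3)[of "f x"], of "w x"] by (simp add: distrib_left mult_ac)
  qed
  also have "\<dots> = (\<integral>\<^sup>+x. w x * modular q (f x) \<partial>M) + b * (\<integral>\<^sup>+x. w x \<partial>M)"
    by (subst nn_integral_add) (auto intro!: nn_integral_cmult)
  also have "\<dots> \<le> (\<integral>\<^sup>+x. w x * modular q (f x) \<partial>M) + b"
    using mult_left_mono[OF w, of b] by (intro add_left_mono) simp
  finally have "y \<le> (\<integral>\<^sup>+x. w x * modular q (f x) \<partial>M)"
    using ab(1) by (simp add: ennreal_add_left_cancel_le add.commute less_top[symmetric])
  with y(1) show False by simp
qed

text \<open>Jensen's inequality on a one-point space with the weight \<open>c\<close>.\<close>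

lemma modular_mult:
  assumes q: "1 \<le> q" and c: "c \<le> 1"
  shows "modular q (c * t) \<le> c * modular q t"
proof -
  have "modular q (\<integral>\<^sup>+i. c * t \<partial>count_space {()}) \<le> (\<integral>\<^sup>+i. c * modular q t \<partial>count_space {()})"
    using c by (intro modular_nn_integral[OF q]) (auto simp: nn_integral_count_space_finite)
  then show ?thesis by (simp add: nn_integral_count_space_finite)
qed

lemma modular_le_1_iff: "1 \<le> q \<Longrightarrow> modular q t \<le> 1 \<longleftrightarrow> t \<le> 1"
proof -
  assume q: "1 \<le> q"
  have "modular q 1 \<le> 1" using one_le_enn2real[OF q] by (auto simp: modular_def)
  moreover have False if "modular q t \<le> 1" "1 < t"
  proof (cases "q = \<infinity> \<or> t = \<infinity>")
    case True with that show False by (auto simp: modular_def top_unique not_le[symmetric] split: if_splits)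
  next
    case False
    then obtain x where x: "t = ennreal x" "0 \<le> x" by (cases t) auto
    then have "1 < x" using that by simp
    then have "1 powr enn2real q < x powr enn2real q"
      using one_le_enn2real[OF q] False by (intro powr_less_mono2) auto
    then show False using that False x by (auto simp: modular_def ennreal_le_1)
  qed
  ultimately show ?thesis using modular_mono[of t 1 q] by (auto intro: order_trans simp: not_le[symmetric])
qed

text \<open>The weight \<open>a\<close> allows the countable Minkowski inequality over blocks to be read off as well.\<close>

lemma schur_weighted:
  assumes q: "1 \<le> q" and "sigma_finite_measure M"
    and [measurable]: "(\<lambda>(x, y). k x y) \<in> borel_measurable (M \<Otimes>\<^sub>M M)"
      "a \<in> borel_measurable M" "f \<in> borel_measurable M"
    and a: "\<And>y. 0 < a y" "\<And>y. a y < \<infinity>" and R: "0 < R" "R < \<infinity>"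
    and 1: "\<And>x. (\<integral>\<^sup>+y. k x y * a y \<partial>M) \<le> R"
    and 2: "(\<integral>\<^sup>+y. (\<integral>\<^sup>+x. k x y \<partial>M) * (a y * modular q (f y / a y)) \<partial>M) \<le> R"
  shows "(\<integral>\<^sup>+x. modular q ((\<integral>\<^sup>+y. k x y * f y \<partial>M) / R) \<partial>M) \<le> 1"
proof -
  interpret sigma_finite_measure M by fact
  interpret pair_sigma_finite M M ..
  have "(\<integral>\<^sup>+x. modular q ((\<integral>\<^sup>+y. k x y * f y \<partial>M) / R) \<partial>M) \<le>
        (\<integral>\<^sup>+x. \<integral>\<^sup>+y. k x y * a y / R * modular q (f y / a y) \<partial>M \<partial>M)"
  proof (rule nn_integral_mono)
    fix x assume [measurable]: "x \<in> space M"
    have "(\<integral>\<^sup>+y. k x y * f y \<partial>M) / R = (\<integral>\<^sup>+y. k x y * a y / R * (f y / a y) \<partial>M)"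
    proof (subst nn_integral_divide[symmetric], measurable, rule nn_integral_cong)
      fix y
      have "k x y * f y = k x y * (f y * (a y / a y))"
        using a[of y] by (simp add: less_top[symmetric])
      also have "\<dots> = k x y * a y * (f y / a y)"
        by (simp add: divide_ennreal_def mult_ac)
      finally show "k x y * f y / R = k x y * a y / R * (f y / a y)"
        by (simp add: divide_ennreal_def mult_ac)
    qed
    \<comment> \<open>For fixed \<open>x\<close> the function \<open>k x y * a y / R\<close> is
      therefore a weight of mass at most 1, and Jensen's inequality applies to
      \<open>f y / a y\<close>.\<close>
    moreover have "(\<integral>\<^sup>+y. k x y * a y / R \<partial>M) \<le> 1"
      using 1[of x] R by (simp add: nn_integral_divide divide_le_posI_ennreal)
    ultimately show "modular q ((\<integral>\<^sup>+y. k x y * f y \<partial>M) / R) \<le>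
          (\<integral>\<^sup>+y. k x y * a y / R * modular q (f y / a y) \<partial>M)"
      by (simp add: modular_nn_integral[OF q])
  qed
  also have "\<dots> = (\<integral>\<^sup>+y. \<integral>\<^sup>+x. k x y * (a y * modular q (f y / a y) / R) \<partial>M \<partial>M)"
    by (subst Fubini') (auto simp: divide_ennreal_def mult_ac)
  also have "\<dots> = (\<integral>\<^sup>+y. (\<integral>\<^sup>+x. k x y \<partial>M) * (a y * modular q (f y / a y)) / R \<partial>M)"
    by (intro nn_integral_cong, subst nn_integral_multc) (auto simp: divide_ennreal_def mult_ac)
  also have "\<dots> \<le> 1"
    using 2 R by (subst nn_integral_divide) (auto simp: divide_le_posI_ennreal)
  finally show ?thesis .
qed

lemma sigma_finite_lebesgue: "sigma_finite_measure (lebesgue :: 'a::euclidean_space measure)"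
proof
  obtain A :: "'a set set" where A: "countable A" "A \<subseteq> sets lborel" "\<Union> A = space lborel"
      "\<forall>a\<in>A. emeasure lborel a \<noteq> \<infinity>"
    using lborel.sigma_finite_countable by blast
  show "\<exists>A::'a set set. countable A \<and> A \<subseteq> sets lebesgue \<and> \<Union> A = space lebesgue \<and>
      (\<forall>a\<in>A. emeasure lebesgue a \<noteq> \<infinity>)"
    by (intro exI[of _ A]) (use A in auto)
qed

lemma nn_integral_count_space_indicator_eq:
  "(\<integral>\<^sup>+m. indicator {m} b * F m \<partial>count_space UNIV) = (F b :: ennreal)"
proof -
  have "(\<integral>\<^sup>+m. indicator {m} b * F m \<partial>count_space UNIV) = (\<integral>\<^sup>+m. F m * indicator {b} m \<partial>count_space UNIV)"
    by (intro nn_integral_cong) (auto simp: indicator_def)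
  then show ?thesis by (simp add: nn_integral_indicator_finite)
qed

lemma borel_measurable_count_space_compose:
  "\<beta> \<in> measurable M (count_space UNIV) \<Longrightarrow> (\<lambda>x. g (\<beta> x)) \<in> borel_measurable M"
  by (erule measurable_compose[where g=g]) simp

text \<open>Splits an integral along the level sets of \<open>\<beta>\<close>. The block index is a
  separate argument of \<open>g\<close>, so whatever depends on it alone is a constant inside each
  inner integral.\<close>

lemma nn_integral_blocks:
  fixes \<beta> :: "'a \<Rightarrow> int"
  assumes [measurable]: "\<beta> \<in> measurable M (count_space UNIV)" "\<And>m. g m \<in> borel_measurable M"
  shows "(\<integral>\<^sup>+y. g (\<beta> y) y \<partial>M) = (\<integral>\<^sup>+m. (\<integral>\<^sup>+y. indicator {m} (\<beta> y) * g m y \<partial>M) \<partial>count_space UNIV)"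
proof -
  note borel_measurable_count_space_compose[OF assms(1), measurable]
  have "(\<integral>\<^sup>+y. g (\<beta> y) y \<partial>M) = (\<integral>\<^sup>+y. \<integral>\<^sup>+m. indicator {m} (\<beta> y) * g m y \<partial>count_space UNIV \<partial>M)"
    by (simp add: nn_integral_count_space_indicator_eq)
  also have "\<dots> = (\<integral>\<^sup>+m. (\<integral>\<^sup>+y. indicator {m} (\<beta> y) * g m y \<partial>M) \<partial>count_space UNIV)"
    by (rule nn_integral_count_space_nn_integral) auto
  finally show ?thesis .
qed

section \<open>Luxemburg balls of L^q and their calculus\<close>

lemma inverse_antimono_ennreal: "a \<le> b \<Longrightarrow> inverse b \<le> inverse a" for a b :: ennreal
proof (cases "a = 0 \<or> b = \<infinity>")
  case False
  assume "a \<le> b"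
  with False show ?thesis
    by (cases a; cases b) (auto simp: inverse_ennreal top_unique ennreal_le_iff2 intro!: ennreal_leI le_imp_inverse_le)
qed auto

text \<open>A predicate on a bound instead of an infimum over bounds: the argument only ever
  transports bounds, and it does so for extended-valued functions such as
  \<open>\<integral>\<^sup>+y. k x y * f y \<partial>lebesgue\<close>, which have no place in
  \<open>Lp\<close>.\<close>

definition Lp_le :: "ennreal \<Rightarrow> (real \<Rightarrow> ennreal) \<Rightarrow> ennreal \<Rightarrow> bool" where
  "Lp_le q f c \<longleftrightarrow> (\<integral>\<^sup>+x. modular q (f x / c) \<partial>lebesgue) \<le> 1"

lemma Lp_le_mono:
  assumes "Lp_le q g c" "\<And>x. f x \<le> g x" "c \<le> c'"
  shows "Lp_le q f c'"
proof -
  have "f x / c' \<le> g x / c" for x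
    unfolding divide_ennreal_def using assms by (intro mult_mono inverse_antimono_ennreal) auto
  then show ?thesis
    using assms(1) unfolding Lp_le_def
    by (elim order_trans[rotated]) (intro nn_integral_mono modular_mono)
qed

text \<open>Minkowski's inequality: \<open>(f x + g x) / (a + b)\<close> is the convex combination
  of \<open>f x / a\<close> and \<open>g x / b\<close> with weights \<open>a / (a + b)\<close> and
  \<open>b / (a + b)\<close>, so Jensen's inequality on the two-point space \<open>bool\<close>
  applies.\<close>

lemma Lp_le_add:
  assumes q: "1 \<le> q" and ab: "0 < a" "a < \<infinity>" "0 < b" "b < \<infinity>"
    and [measurable]: "f \<in> borel_measurable lebesgue" "g \<in> borel_measurable lebesgue"
    and f: "Lp_le q f a" and g: "Lp_le q g b"
  shows "Lp_le q (\<lambda>x. f x + g x) (a + b)"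
proof -
  let ?c = "a + b"
  have c: "0 < ?c" "?c < \<infinity>" using ab by (auto simp: add_pos_pos)
  have sum1: "a / ?c + b / ?c = 1"
    using c ennreal_divide_self[of ?c] unfolding add_divide_distrib_ennreal[symmetric] infinity_ennreal_def
    by (metis less_irrefl)
  have *: "modular q ((f x + g x) / ?c) \<le> a / ?c * modular q (f x / a) + b / ?c * modular q (g x / b)" for x
  proof -
    have "a * inverse a = 1" "b * inverse b = 1"
      using ab ennreal_divide_self[of a] ennreal_divide_self[of b] by (auto simp: divide_ennreal_def)
    moreover have "a / ?c * (f x / a) = f x / ?c * (a * inverse a)" "b / ?c * (g x / b) = g x / ?c * (b * inverse b)"
      by (simp_all only: divide_ennreal_def mult_ac)
    ultimately have "a / ?c * (f x / a) = f x / ?c" "b / ?c * (g x / b) = g x / ?c"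
      by simp_all
    then have "(f x + g x) / ?c = (\<integral>\<^sup>+i. (if i then a / ?c else b / ?c) * (if i then f x / a else g x / b) \<partial>count_space UNIV)"
      by (simp add: nn_integral_count_space_finite UNIV_bool add_divide_distrib_ennreal add.commute)
    moreover have "(\<integral>\<^sup>+i. (if i then a / ?c else b / ?c) \<partial>count_space UNIV) \<le> 1"
      using sum1 by (simp add: nn_integral_count_space_finite UNIV_bool add.commute)
    ultimately have "modular q ((f x + g x) / ?c)
        \<le> (\<integral>\<^sup>+i. (if i then a / ?c else b / ?c) * modular q (if i then f x / a else g x / b) \<partial>count_space UNIV)"
      by (simp only:) (rule modular_nn_integral[OF q], auto)
    also have "\<dots> = a / ?c * modular q (f x / a) + b / ?c * modular q (g x / b)"
      by (simp add: nn_integral_count_space_finite UNIV_bool add.commute)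
    finally show ?thesis .
  qed
  have "(\<integral>\<^sup>+x. modular q ((f x + g x) / ?c) \<partial>lebesgue)
      \<le> (\<integral>\<^sup>+x. a / ?c * modular q (f x / a) + b / ?c * modular q (g x / b) \<partial>lebesgue)"
    by (intro nn_integral_mono *)
  also have "\<dots> = a / ?c * (\<integral>\<^sup>+x. modular q (f x / a) \<partial>lebesgue) + b / ?c * (\<integral>\<^sup>+x. modular q (g x / b) \<partial>lebesgue)"
    by (subst nn_integral_add) (auto intro!: arg_cong2[where f="(+)"] nn_integral_cmult)
  also have "\<dots> \<le> a / ?c * 1 + b / ?c * 1"
    using f g unfolding Lp_le_def by (intro add_mono mult_left_mono) auto
  finally show ?thesis using sum1 by (simp add: Lp_le_def)
qed

text \<open>The bridge between Luxemburg bounds and \<open>Lp_norm\<close>. As \<open>c\<close> has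
  to be positive, a norm that may vanish is approached from above: users insert a slightly larger
  \<open>c\<close> and let it decrease.\<close>

lemma Lp_le_iff:
  assumes q: "1 \<le> q" and c: "0 < c" and [measurable]: "f \<in> borel_measurable lebesgue"
  shows "Lp_le q (\<lambda>x. ennreal (cmod (f x))) (ennreal c) \<longleftrightarrow> f \<in> Lp q \<and> Lp_norm q f \<le> c"
proof (cases "q = \<infinity>")
  case True
  \<comment> \<open>For this exponent the modular takes only the values 0 and infinity, so its
    integral is at most 1 exactly if the set where \<open>c\<close> is exceeded is null.\<close>
  have "Lp_le q (\<lambda>x. ennreal (cmod (f x))) (ennreal c) \<longleftrightarrow>
      (\<integral>\<^sup>+x. \<infinity> * indicator {x. c < cmod (f x)} x \<partial>lebesgue) \<le> 1"
    unfolding Lp_le_def using True c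
    by (intro arg_cong[where f="\<lambda>x. x \<le> 1"] nn_integral_cong)
      (auto simp: modular_def divide_ennreal ennreal_le_1 field_simps)
  also have "\<dots> \<longleftrightarrow> (AE x in lebesgue. cmod (f x) \<le> c)"
  proof -
    have "{x \<in> space lebesgue. c < cmod (f x)} \<in> sets lebesgue"
      by measurable
    then have m: "{x. c < cmod (f x)} \<in> sets lebesgue"
      by simp
    have "(\<integral>\<^sup>+x. \<infinity> * indicator {x. c < cmod (f x)} x \<partial>lebesgue) = \<infinity> * emeasure lebesgue {x. c < cmod (f x)}"
      using m by (simp add: nn_integral_cmult_indicator)
    also have "\<dots> \<le> 1 \<longleftrightarrow> emeasure lebesgue {x. c < cmod (f x)} = 0"
      by (cases "emeasure lebesgue {x. c < cmod (f x)} = 0") (auto simp: top_unique ennreal_top_mult)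
    also have "\<dots> \<longleftrightarrow> (AE x in lebesgue. cmod (f x) \<le> c)"
      using m by (subst AE_iff_measurable[OF _ refl]) (auto simp: not_le)
    finally show ?thesis .
  qed
  also have "\<dots> \<longleftrightarrow> esssup lebesgue (\<lambda>x. ennreal (cmod (f x))) \<le> ennreal c"
  proof
    assume "AE x in lebesgue. cmod (f x) \<le> c"
    then show "esssup lebesgue (\<lambda>x. ennreal (cmod (f x))) \<le> ennreal c"
      by (intro esssup_I) (auto elim!: eventually_mono intro: ennreal_leI)
  next
    assume le: "esssup lebesgue (\<lambda>x. ennreal (cmod (f x))) \<le> ennreal c"
    from esssup_AE[of "\<lambda>x. ennreal (cmod (f x))" lebesgue]
    show "AE x in lebesgue. cmod (f x) \<le> c"
    proof eventually_elim
      case (elim x)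
      then have "ennreal (cmod (f x)) \<le> ennreal c" using le by (rule order_trans)
      then show ?case using c by simp
    qed
  qed
  also have "\<dots> \<longleftrightarrow> f \<in> Lp q \<and> Lp_norm q f \<le> c"
    using True c unfolding Lp_def Lp_norm_def
    by (cases "esssup lebesgue (\<lambda>x. ennreal (cmod (f x)))") (auto simp: top_unique)
  finally show ?thesis .
next
  case False
  define r where "r = enn2real q"
  have r: "1 \<le> r" using one_le_enn2real[OF q False] by (simp add: r_def)
  define I where "I = (\<integral>\<^sup>+x. ennreal (cmod (f x) powr r) \<partial>lebesgue)"
  have "(\<integral>\<^sup>+x. modular q (ennreal (cmod (f x)) / ennreal c) \<partial>lebesgue)
      = (\<integral>\<^sup>+x. ennreal (cmod (f x) powr r) / ennreal (c powr r) \<partial>lebesgue)"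
    using False c by (intro nn_integral_cong)
      (auto simp: modular_def divide_ennreal r_def[symmetric] powr_divide)
  also have "\<dots> = I / ennreal (c powr r)"
    by (simp add: nn_integral_divide I_def)
  finally have "Lp_le q (\<lambda>x. ennreal (cmod (f x))) (ennreal c) \<longleftrightarrow> I / ennreal (c powr r) \<le> 1"
    by (simp add: Lp_le_def)
  also have "\<dots> \<longleftrightarrow> I \<le> ennreal (c powr r)"
    using c by (cases I) (auto simp: divide_ennreal ennreal_le_1 ennreal_top_divide top_unique)
  also have "\<dots> \<longleftrightarrow> f \<in> Lp q \<and> Lp_norm q f \<le> c"
  proof (cases "I = \<infinity>")
    case True
    then have "f \<notin> Lp q" using False
      by (auto simp: Lp_def integrable_iff_bounded I_def r_def)
    then show ?thesis using True by (simp add: top_unique)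
  next
    case I: False
    then have "f \<in> Lp q" using False
      by (auto simp: Lp_def integrable_iff_bounded I_def r_def less_top)
    moreover have "(LINT x|lebesgue. cmod (f x) powr r) = enn2real I"
      unfolding I_def by (intro integral_eq_nn_integral) auto
    then have "Lp_norm q f = enn2real I powr (1 / r)"
      using False by (simp add: Lp_norm_def r_def)
    moreover have "enn2real I powr (1 / r) \<le> c \<longleftrightarrow> enn2real I \<le> c powr r"
    proof
      assume "enn2real I powr (1 / r) \<le> c"
      then have "(enn2real I powr (1 / r)) powr r \<le> c powr r"
        using r by (intro powr_mono2) auto
      then show "enn2real I \<le> c powr r" using r by (simp add: powr_powr)
    next
      assume "enn2real I \<le> c powr r"
      then have "enn2real I powr (1 / r) \<le> (c powr r) powr (1 / r)"
        using r by (intro powr_mono2) auto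
      then show "enn2real I powr (1 / r) \<le> c" using r c by (simp add: powr_powr)
    qed
    ultimately show ?thesis using I by (cases I) auto
  qed
  finally show ?thesis .
qed

lemma Lp_le_schur:
  assumes q: "1 \<le> q"
    and k [measurable]: "(\<lambda>(x, y). k x y) \<in> borel_measurable (lebesgue \<Otimes>\<^sub>M lebesgue)"
    and [measurable]: "f \<in> borel_measurable lebesgue"
    and c: "0 < c" "c < \<infinity>" and S: "0 < S" "S < \<infinity>"
    and 1: "\<And>x. (\<integral>\<^sup>+y. k x y \<partial>lebesgue) \<le> S" and 2: "\<And>y. (\<integral>\<^sup>+x. k x y \<partial>lebesgue) \<le> S"
    and f: "Lp_le q f c"
  shows "Lp_le q (\<lambda>x. \<integral>\<^sup>+y. k x y * f y \<partial>lebesgue) (S * c)"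
  unfolding Lp_le_def
proof (rule schur_weighted[OF q sigma_finite_lebesgue k, where a="\<lambda>_. c"])
  show "(\<integral>\<^sup>+y. k x y * c \<partial>lebesgue) \<le> S * c" for x
    using 1 by (subst nn_integral_multc) (auto intro!: mult_right_mono)
  have "(\<integral>\<^sup>+y. (\<integral>\<^sup>+x. k x y \<partial>lebesgue) * (c * modular q (f y / c)) \<partial>lebesgue)
      \<le> (\<integral>\<^sup>+y. S * c * modular q (f y / c) \<partial>lebesgue)"
    using 2 by (auto intro!: nn_integral_mono mult_right_mono simp: mult.assoc)
  also have "\<dots> = S * c * (\<integral>\<^sup>+y. modular q (f y / c) \<partial>lebesgue)"
    by (intro nn_integral_cmult) measurable
  also have "\<dots> \<le> S * c * 1"
    using f unfolding Lp_le_def by (intro mult_left_mono) auto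
  finally show "(\<integral>\<^sup>+y. (\<integral>\<^sup>+x. k x y \<partial>lebesgue) * (c * modular q (f y / c)) \<partial>lebesgue) \<le> S * c"
    by simp
qed (use c S in \<open>auto simp: ennreal_zero_less_mult_iff ennreal_mult_less_top\<close>)

text \<open>Taking \<open>A (\<beta> y)\<close> as the Schur weight makes the modular of the
  rescaled \<open>f\<close> at most 1 on each block, so block \<open>m\<close> contributes
  \<open>s m * A m\<close>. The result is the triangle inequality over countably many blocks, each
  estimated by Schur's test.\<close>

lemma Lp_le_block_schur:
  fixes \<beta> :: "real \<Rightarrow> int"
  assumes q: "1 \<le> q"
    and k [measurable]: "(\<lambda>(x, y). k x y) \<in> borel_measurable (lebesgue \<Otimes>\<^sub>M lebesgue)"
    and f [measurable]: "f \<in> borel_measurable lebesgue"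
    and \<beta> [measurable]: "\<beta> \<in> measurable lebesgue (count_space UNIV)"
    and A: "\<And>m. 0 < A m" "\<And>m. A m < \<infinity>"
    and 1: "\<And>m x. (\<integral>\<^sup>+y. indicator {m} (\<beta> y) * k x y \<partial>lebesgue) \<le> s m"
    and 2: "\<And>y. (\<integral>\<^sup>+x. k x y \<partial>lebesgue) \<le> s (\<beta> y)"
    and le: "\<And>m. Lp_le q (\<lambda>y. indicator {m} (\<beta> y) * f y) (A m)"
    and R: "(\<integral>\<^sup>+m. s m * A m \<partial>count_space UNIV) \<le> R" "0 < R" "R < \<infinity>"
  shows "Lp_le q (\<lambda>x. \<integral>\<^sup>+y. k x y * f y \<partial>lebesgue) R"
proof -
  note borel_measurable_count_space_compose[OF \<beta>, measurable]
  have "(\<integral>\<^sup>+x. modular q ((\<integral>\<^sup>+y. k x y * f y \<partial>lebesgue) / R) \<partial>lebesgue) \<le> 1"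
  proof (rule schur_weighted[OF q sigma_finite_lebesgue k, where a="\<lambda>y. A (\<beta> y)"])
    show "(\<integral>\<^sup>+y. k x y * A (\<beta> y) \<partial>lebesgue) \<le> R" for x
    proof -
      have "(\<integral>\<^sup>+y. k x y * A (\<beta> y) \<partial>lebesgue)
          = (\<integral>\<^sup>+m. (\<integral>\<^sup>+y. indicator {m} (\<beta> y) * (k x y * A m) \<partial>lebesgue) \<partial>count_space UNIV)"
        by (rule nn_integral_blocks) measurable
      also have "\<dots> = (\<integral>\<^sup>+m. (\<integral>\<^sup>+y. indicator {m} (\<beta> y) * k x y \<partial>lebesgue) * A m \<partial>count_space UNIV)"
        by (intro nn_integral_cong) (simp add: nn_integral_multc flip: mult.assoc)
      also have "\<dots> \<le> (\<integral>\<^sup>+m. s m * A m \<partial>count_space UNIV)"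
        using 1 by (intro nn_integral_mono mult_right_mono) auto
      finally show ?thesis using R(1) by (rule order_trans)
    qed
    have "(\<integral>\<^sup>+y. (\<integral>\<^sup>+x. k x y \<partial>lebesgue) * (A (\<beta> y) * modular q (f y / A (\<beta> y))) \<partial>lebesgue)
        \<le> (\<integral>\<^sup>+y. s (\<beta> y) * A (\<beta> y) * modular q (f y / A (\<beta> y)) \<partial>lebesgue)"
      using 2 by (auto intro!: nn_integral_mono mult_right_mono simp: mult.assoc)
    also have "\<dots> = (\<integral>\<^sup>+m. (\<integral>\<^sup>+y. indicator {m} (\<beta> y) * (s m * A m * modular q (f y / A m)) \<partial>lebesgue) \<partial>count_space UNIV)"
      by (rule nn_integral_blocks) measurable
    also have "\<dots> = (\<integral>\<^sup>+m. (\<integral>\<^sup>+y. s m * A m * modular q (indicator {m} (\<beta> y) * f y / A m) \<partial>lebesgue) \<partial>count_space UNIV)"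
      by (intro nn_integral_cong) (auto simp: indicator_def)
    also have "\<dots> = (\<integral>\<^sup>+m. s m * A m * (\<integral>\<^sup>+y. modular q (indicator {m} (\<beta> y) * f y / A m) \<partial>lebesgue) \<partial>count_space UNIV)"
      by (intro nn_integral_cong nn_integral_cmult) measurable
    also have "\<dots> \<le> (\<integral>\<^sup>+m. s m * A m * 1 \<partial>count_space UNIV)"
      using le unfolding Lp_le_def by (intro nn_integral_mono mult_left_mono) auto
    finally show "(\<integral>\<^sup>+y. (\<integral>\<^sup>+x. k x y \<partial>lebesgue) * (A (\<beta> y) * modular q (f y / A (\<beta> y))) \<partial>lebesgue) \<le> R"
      using R(1) by simp
  qed (use A R in auto)
  then show ?thesis by (simp add: Lp_le_def)
qed

section \<open>Convolution of integer sequences\<close>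

text \<open>An integral over the counting measure with values in \<open>ennreal\<close> makes
  Tonelli's theorem available without summability conditions.\<close>

definition conv :: "(int \<Rightarrow> ennreal) \<Rightarrow> (int \<Rightarrow> ennreal) \<Rightarrow> int \<Rightarrow> ennreal" where
  "conv a b n = (\<integral>\<^sup>+m. a (n - m) * b m \<partial>count_space UNIV)"

definition mass :: "(int \<Rightarrow> ennreal) \<Rightarrow> ennreal" where
  "mass a = (\<integral>\<^sup>+m. a m \<partial>count_space UNIV)"

lemma nn_integral_int_shift:
  fixes f :: "int \<Rightarrow> ennreal"
  shows "(\<integral>\<^sup>+m. f (m + n) \<partial>count_space UNIV) = (\<integral>\<^sup>+m. f m \<partial>count_space UNIV)"
    and "(\<integral>\<^sup>+m. f (m - n) \<partial>count_space UNIV) = (\<integral>\<^sup>+m. f m \<partial>count_space UNIV)"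
    and "(\<integral>\<^sup>+m. f (n - m) \<partial>count_space UNIV) = (\<integral>\<^sup>+m. f m \<partial>count_space UNIV)"
  by (rule nn_integral_bij_count_space, rule bij_betw_byWitness[where f'="\<lambda>m. m - n"], auto)
    (rule nn_integral_bij_count_space, rule bij_betw_byWitness[where f'="\<lambda>m. m + n"], auto,
     rule nn_integral_bij_count_space, rule bij_betw_byWitness[where f'="\<lambda>m. n - m"], auto)

lemma nn_integral_count_space_swap:
  fixes f :: "int \<Rightarrow> int \<Rightarrow> ennreal"
  shows "(\<integral>\<^sup>+m. \<integral>\<^sup>+k. f m k \<partial>count_space UNIV \<partial>count_space UNIV) =
    (\<integral>\<^sup>+k. \<integral>\<^sup>+m. f m k \<partial>count_space UNIV \<partial>count_space UNIV)"
  by (rule nn_integral_count_space_nn_integral) auto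

lemma conv_mono: "(\<And>m. a m \<le> a' m) \<Longrightarrow> (\<And>m. b m \<le> b' m) \<Longrightarrow> conv a b n \<le> conv a' b' n"
  unfolding conv_def by (intro nn_integral_mono mult_mono) auto

lemma conv_assoc: "conv (conv a b) c n = conv a (conv b c) n"
proof -
  have "conv a (conv b c) n = (\<integral>\<^sup>+j. \<integral>\<^sup>+m. a (n - j) * (b (j - m) * c m) \<partial>count_space UNIV \<partial>count_space UNIV)"
    unfolding conv_def by (simp add: nn_integral_cmult)
  also have "\<dots> = (\<integral>\<^sup>+m. \<integral>\<^sup>+j. a (n - j) * (b (j - m) * c m) \<partial>count_space UNIV \<partial>count_space UNIV)"
    by (rule nn_integral_count_space_swap)
  also have "\<dots> = (\<integral>\<^sup>+m. \<integral>\<^sup>+k. a (n - m - k) * b k * c m \<partial>count_space UNIV \<partial>count_space UNIV)"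
  proof (rule nn_integral_cong)
    fix m
    show "(\<integral>\<^sup>+j. a (n - j) * (b (j - m) * c m) \<partial>count_space UNIV)
        = (\<integral>\<^sup>+k. a (n - m - k) * b k * c m \<partial>count_space UNIV)"
      using nn_integral_int_shift(1)[of "\<lambda>j. a (n - j) * (b (j - m) * c m)" m]
      by (simp add: algebra_simps)
  qed
  also have "\<dots> = conv (conv a b) c n"
    unfolding conv_def by (simp add: nn_integral_multc)
  finally show ?thesis by simp
qed

lemma conv_add_left: "conv (\<lambda>m. a m + b m) c n = conv a c n + conv b c n"
  unfolding conv_def by (simp add: distrib_right nn_integral_add)

lemma conv_add_right: "conv a (\<lambda>m. b m + c m) n = conv a b n + conv a c n"
  unfolding conv_def by (simp add: distrib_left nn_integral_add)

lemma conv_cmult_left: "conv (\<lambda>m. c * a m) b n = c * conv a b n"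
  unfolding conv_def by (simp add: nn_integral_cmult mult.assoc)

lemma conv_cmult_right: "conv a (\<lambda>m. c * b m) n = c * conv a b n"
  unfolding conv_def by (subst nn_integral_cmult[symmetric]) (simp_all add: mult_ac)

lemma mass_add: "mass (\<lambda>m. a m + b m) = mass a + mass b"
  unfolding mass_def by (simp add: nn_integral_add)

lemma mass_cmult: "mass (\<lambda>m. c * a m) = c * mass a"
  unfolding mass_def by (simp add: nn_integral_cmult)

lemma mass_conv: "mass (conv a b) = mass a * mass b"
proof -
  have "mass (conv a b) = (\<integral>\<^sup>+m. \<integral>\<^sup>+n. a (n - m) * b m \<partial>count_space UNIV \<partial>count_space UNIV)"
    unfolding mass_def conv_def by (rule nn_integral_count_space_swap)
  also have "\<dots> = (\<integral>\<^sup>+m. mass a * b m \<partial>count_space UNIV)"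
    by (simp add: nn_integral_multc nn_integral_int_shift(2) mass_def)
  finally show ?thesis by (simp add: nn_integral_cmult mass_def)
qed

lemma conv_le_mass: "(\<And>m. b m \<le> M) \<Longrightarrow> conv a b n \<le> mass a * M"
proof -
  assume "\<And>m. b m \<le> M"
  then have "conv a b n \<le> (\<integral>\<^sup>+m. a (n - m) * M \<partial>count_space UNIV)"
    unfolding conv_def by (intro nn_integral_mono mult_left_mono) auto
  also have "\<dots> = mass a * M"
    by (simp add: nn_integral_multc nn_integral_int_shift(3) mass_def)
  finally show ?thesis .
qed

section \<open>Neumann series for convolution on the integers\<close>

primrec conv_pow :: "(int \<Rightarrow> ennreal) \<Rightarrow> nat \<Rightarrow> int \<Rightarrow> ennreal" where
  "conv_pow t 0 = indicator {0}"
| "conv_pow t (Suc k) = conv (conv_pow t k) t"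

text \<open>For \<open>mass t\<close> below 1 this is the convolution inverse of delta minus
  \<open>t\<close>, where delta is \<open>indicator {0}\<close>.\<close>

definition neumann :: "(int \<Rightarrow> ennreal) \<Rightarrow> int \<Rightarrow> ennreal" where
  "neumann t n = (\<Sum>k. conv_pow t k n)"

lemma conv_delta: "conv (indicator {0}) b n = b n"
proof -
  have "conv (indicator {0}) b n = (\<integral>\<^sup>+m. indicator {m} n * b m \<partial>count_space UNIV)"
    unfolding conv_def by (intro nn_integral_cong) (auto simp: indicator_def)
  then show ?thesis by (simp add: nn_integral_count_space_indicator_eq)
qed

lemma mass_conv_pow: "mass (conv_pow t k) = mass t ^ k"
proof (induction k)
  case 0
  then show ?case by (simp add: mass_def nn_integral_indicator_finite one_ennreal_def[symmetric])
qed (simp add: mass_conv mult.commute)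

lemma suminf_half_ennreal: "(\<Sum>k. (1 / 2 :: ennreal) ^ k) = 2"
proof -
  have "(\<Sum>k. (1 / 2 :: ennreal) ^ k) = (\<Sum>k. ennreal ((1 / 2) ^ k))"
    by (simp add: ennreal_power[symmetric] ennreal_divide_numeral divide_ennreal_def)
  also have "\<dots> = ennreal (\<Sum>k. (1 / 2) ^ k)"
    by (intro suminf_ennreal_eq) (auto intro!: summable_sums summable_geometric)
  also have "\<dots> = 2" by (simp add: suminf_geometric)
  finally show ?thesis .
qed

lemma mass_neumann:
  assumes "mass t \<le> 1 / 2"
  shows "mass (neumann t) \<le> 2"
proof -
  have "mass (neumann t) = (\<Sum>k. mass (conv_pow t k))"
    unfolding mass_def neumann_def by (rule nn_integral_suminf) auto
  also have "\<dots> \<le> (\<Sum>k. (1 / 2) ^ k)"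
    using assms by (intro suminf_le) (auto simp: mass_conv_pow power_mono)
  finally show ?thesis by (simp add: suminf_half_ennreal)
qed

text \<open>Iterating the inequality \<open>k\<close> times leaves the remainder
  \<open>conv (conv_pow t k) a n\<close>, at most \<open>(1 / 2) ^ k * M\<close>. Some a priori
  bound is indispensable, since \<open>a = \<infinity>\<close> can satisfy \<open>le\<close> as
  well; its size is irrelevant and \<open>M\<close> is absent from the conclusion.\<close>

lemma le_conv_neumann:
  assumes t: "mass t \<le> 1 / 2" and bdd: "\<And>n. a n \<le> M" "M < \<infinity>"
    and le: "\<And>n. a n \<le> b n + conv t a n"
  shows "a n \<le> conv (neumann t) b n"
proof -
  have step: "a n \<le> (\<Sum>i<k. conv (conv_pow t i) b n) + conv (conv_pow t k) a n" for k n
  proof (induction k)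
    case 0
    then show ?case by (simp add: conv_delta)
  next
    case (Suc k)
    have "conv (conv_pow t k) a n \<le> conv (conv_pow t k) (\<lambda>n. b n + conv t a n) n"
      using le by (intro conv_mono) auto
    also have "\<dots> = conv (conv_pow t k) b n + conv (conv_pow t (Suc k)) a n"
      by (simp add: conv_add_right conv_assoc[abs_def])
    finally have "(\<Sum>i<k. conv (conv_pow t i) b n) + conv (conv_pow t k) a n
        \<le> (\<Sum>i<Suc k. conv (conv_pow t i) b n) + conv (conv_pow t (Suc k)) a n"
      by (simp add: add.assoc add_left_mono)
    with Suc show ?case by (rule order_trans)
  qed
  have "a n \<le> conv (neumann t) b n + (1 / 2) ^ k * M" for k
  proof -
    have "(\<Sum>i<k. conv (conv_pow t i) b n) \<le> (\<Sum>i. conv (conv_pow t i) b n)"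
      by (rule sum_le_suminf) auto
    also have "\<dots> = conv (neumann t) b n"
      unfolding conv_def neumann_def by (simp add: nn_integral_suminf[symmetric])
    finally have 1: "(\<Sum>i<k. conv (conv_pow t i) b n) \<le> conv (neumann t) b n" .
    have "conv (conv_pow t k) a n \<le> mass t ^ k * M"
      using bdd(1) conv_le_mass[of a M "conv_pow t k" n] by (simp add: mass_conv_pow)
    also have "\<dots> \<le> (1 / 2) ^ k * M"
      using t by (intro mult_right_mono power_mono) auto
    finally show ?thesis
      using step[of n k] 1 by (meson add_mono order_trans)
  qed
  moreover have "(\<lambda>k. conv (neumann t) b n + (1 / 2) ^ k * M) \<longlonglongrightarrow> conv (neumann t) b n + 0"
  proof (intro tendsto_add tendsto_const)
    obtain M' where M': "M = ennreal M'" "0 \<le> M'" using bdd(2) by (cases M) auto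
    have eq: "(1 / 2) ^ k * M = ennreal ((1 / 2) ^ k * M')" for k
    proof -
      have "(1 / 2 :: ennreal) = ennreal (1 / 2)" by (simp add: divide_ennreal_def)
      then show ?thesis using M' by (simp add: ennreal_power ennreal_mult'' del: ennreal_half)
    qed
    have "(\<lambda>k. (1 / 2) ^ k * M') \<longlonglongrightarrow> 0 * M'"
      by (intro tendsto_mult LIMSEQ_power_zero tendsto_const) auto
    then show "(\<lambda>k. (1 / 2) ^ k * M) \<longlonglongrightarrow> 0"
      unfolding eq by (metis ennreal_0 mult_zero_left tendsto_ennrealI)
  qed
  ultimately show ?thesis
    by (intro LIMSEQ_le_const[where x="conv (neumann t) b n"]) auto
qed

text \<open>Links the infinite sum in \<open>wiener_norm\<close> to \<open>mass\<close>: enumerating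
  the integers by \<open>int_decode\<close>, every partial sum is one of the finite sums whose
  supremum is the infinite sum.\<close>

lemma mass_le_infsum: "mass f \<le> (\<Sum>\<^sub>\<infinity>k\<in>UNIV. f k)"
proof -
  have "mass f = (\<Sum>i. f (int_decode i))"
    unfolding mass_def by (subst nn_integral_count_space_nat[symmetric], rule nn_integral_bij_count_space[symmetric])
      (simp add: bij_int_decode)
  also have "\<dots> = (SUP n. \<Sum>i<n. f (int_decode i))"
    by (rule suminf_eq_SUP)
  also have "\<dots> \<le> (SUP F\<in>{F. finite F \<and> F \<subseteq> UNIV}. sum f F)"
  proof (rule SUP_least)
    fix n
    have "(\<Sum>i<n. f (int_decode i)) = sum f (int_decode ` {..<n})"
      by (subst sum.reindex) (auto intro: inj_onI inj_int_decode[THEN injD])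
    then show "(\<Sum>i<n. f (int_decode i)) \<le> (SUP F\<in>{F. finite F \<and> F \<subseteq> UNIV}. sum f F)"
      by (simp only:) (rule SUP_upper, auto)
  qed
  also have "\<dots> = (\<Sum>\<^sub>\<infinity>k\<in>UNIV. f k)"
    by (rule nonneg_infsum_complete[symmetric]) simp
  finally show ?thesis .
qed

lemma mass_compose_inj: "inj g \<Longrightarrow> mass (\<lambda>m. f (g m)) \<le> mass f"
proof -
  assume "inj g"
  then have "mass (\<lambda>m. f (g m)) = (\<integral>\<^sup>+m. f m \<partial>count_space (range g))"
    unfolding mass_def by (intro nn_integral_bij_count_space) (simp add: bij_betw_def)
  also have "\<dots> = (\<integral>\<^sup>+m. f m * indicator (range g) m \<partial>count_space UNIV)"
    by (simp add: nn_integral_count_space_indicator)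
  also have "\<dots> \<le> mass f"
    unfolding mass_def by (intro nn_integral_mono) (auto simp: indicator_def)
  finally show ?thesis .
qed

lemma mass_sum: "mass (\<lambda>m. \<Sum>i\<in>I. f i m) = (\<Sum>i\<in>I. mass (f i))"
  unfolding mass_def by (rule nn_integral_sum) auto

section \<open>Blocks and amalgam bounds\<close>

text \<open>The kernels are Borel on the plane while the functions are Lebesgue measurable. The
  identity is measurable from the product of the completed measures to the Borel product, so both
  fit into one Tonelli argument.\<close>

lemma measurable_lebesgue_pair:
  assumes "f \<in> measurable (borel \<Otimes>\<^sub>M borel) N"
  shows "f \<in> measurable (lebesgue \<Otimes>\<^sub>M lebesgue) N"
proof -
  have "(\<lambda>z. (fst z, snd z)) \<in> measurable (lebesgue \<Otimes>\<^sub>M lebesgue) (borel \<Otimes>\<^sub>M borel)"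
    by (intro measurable_Pair measurable_compose[OF measurable_fst id_borel_measurable_lebesgue[unfolded id_def]]
        measurable_compose[OF measurable_snd id_borel_measurable_lebesgue[unfolded id_def]])
  from measurable_compose[OF this assms] show ?thesis by simp
qed

lemma nn_integral_lebesgue_translate:
  fixes g :: "real \<Rightarrow> ennreal"
  assumes [measurable]: "g \<in> borel_measurable borel"
  shows "(\<integral>\<^sup>+y. g (x - y) \<partial>lebesgue) = (\<integral>\<^sup>+t. g t \<partial>lebesgue)"
    and "(\<integral>\<^sup>+x. g (x - y) \<partial>lebesgue) = (\<integral>\<^sup>+t. g t \<partial>lebesgue)"
proof -
  have "g \<in> borel_measurable lebesgue" by (simp add: measurable_completion)
  from nn_integral_real_affine_lebesgue[OF this, of "-1" x] nn_integral_real_affine_lebesgue[OF this, of 1 "-y"]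
  show "(\<integral>\<^sup>+y. g (x - y) \<partial>lebesgue) = (\<integral>\<^sup>+t. g t \<partial>lebesgue)"
    "(\<integral>\<^sup>+x. g (x - y) \<partial>lebesgue) = (\<integral>\<^sup>+t. g t \<partial>lebesgue)"
    by simp_all
qed

definition block :: "nat \<Rightarrow> real \<Rightarrow> int" where
  "block N x = \<lfloor>x / real N\<rfloor>"

lemma measurable_block_borel [measurable]: "block N \<in> measurable borel (count_space UNIV)"
  unfolding block_def by measurable

lemma measurable_block [measurable]: "block N \<in> measurable lebesgue (count_space UNIV)"
  using measurable_compose[OF id_borel_measurable_lebesgue measurable_block_borel[of N]] by simp

lemmas measurable_block_compose [measurable] =
  borel_measurable_count_space_compose[OF measurable_block]
  borel_measurable_count_space_compose[OF measurable_block_borel]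

lemma block_eq_iff: "0 < N \<Longrightarrow> block N x = m \<longleftrightarrow> real N * m \<le> x \<and> x < real N * (m + 1)"
  unfolding block_def floor_eq_iff by (simp add: field_simps)

lemma nn_integral_block:
  assumes "0 < N"
  shows "(\<integral>\<^sup>+y. indicator {m} (block N y) \<partial>lebesgue) = of_nat N"
proof -
  have "(\<integral>\<^sup>+y. indicator {m} (block N y) \<partial>lebesgue) = (\<integral>\<^sup>+y. indicator {real N * m..<real N * (m + 1)} y \<partial>lebesgue)"
    using assms by (intro nn_integral_cong) (auto simp: indicator_def block_eq_iff)
  also have "\<dots> = ennreal (real N * (m + 1) - real N * m)"
    by (simp add: mult_left_mono)
  also have "\<dots> = of_nat N"
    by (simp add: algebra_simps ennreal_of_nat_eq_real_of_nat)
  finally show ?thesis .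
qed

definition block_integral :: "nat \<Rightarrow> (real \<Rightarrow> ennreal) \<Rightarrow> int \<Rightarrow> ennreal" where
  "block_integral N F n = (\<integral>\<^sup>+y. indicator {n} (block N y) * F y \<partial>lebesgue)"

text \<open>Hoelder's inequality on a block, as Jensen's inequality for the density 1/N: the mean of
  \<open>F / c\<close> has modular at most 1, hence is at most 1. The sharp factor is N^(1-1/q);
  since \<open>N\<close> is at least 1, the factor \<open>N\<close> serves all exponents at
  once.\<close>

lemma block_integral_le:
  assumes q: "1 \<le> q" and N: "0 < N" and c: "0 < c" "c < \<infinity>"
    and [measurable]: "F \<in> borel_measurable lebesgue"
    and le: "Lp_le q (\<lambda>y. indicator {n} (block N y) * F y) c"
  shows "block_integral N F n \<le> of_nat N * c"
proof -
  let ?w = "\<lambda>y. indicator {n} (block N y) / of_nat N :: ennreal"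
  let ?I = "\<lambda>y. indicator {n} (block N y) :: ennreal"
  have w: "(\<integral>\<^sup>+y. ?w y \<partial>lebesgue) \<le> 1"
    using N by (subst nn_integral_divide)
      (auto simp: nn_integral_block ennreal_divide_self of_nat_less_top)
  have "modular q (\<integral>\<^sup>+y. ?w y * (?I y * F y / c) \<partial>lebesgue)
      \<le> (\<integral>\<^sup>+y. ?w y * modular q (?I y * F y / c) \<partial>lebesgue)"
    by (intro modular_nn_integral q w) auto
  also have "\<dots> \<le> (\<integral>\<^sup>+y. 1 * modular q (?I y * F y / c) \<partial>lebesgue)"
  proof (intro nn_integral_mono mult_right_mono)
    have "1 \<le> (of_nat N :: ennreal)" using N by (metis One_nat_def Suc_leI of_nat_1 of_nat_mono)
    then show "?w y \<le> 1" for y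
      using N by (intro divide_le_posI_ennreal) (auto simp: indicator_def intro: order_trans)
  qed simp
  also have "\<dots> \<le> 1" using le by (simp add: Lp_le_def)
  finally have "(\<integral>\<^sup>+y. ?w y * (?I y * F y / c) \<partial>lebesgue) \<le> 1"
    using q by (simp add: modular_le_1_iff)
  moreover have "(\<integral>\<^sup>+y. ?w y * (?I y * F y / c) \<partial>lebesgue) = block_integral N F n / (of_nat N * c)"
  proof -
    have inv: "inverse (of_nat N * c) = inverse (of_nat N) * inverse c"
      using c by (intro ennreal_inverse_mult) (auto simp: of_nat_less_top)
    have "(\<integral>\<^sup>+y. ?w y * (?I y * F y / c) \<partial>lebesgue) = (\<integral>\<^sup>+y. ?I y * F y / (of_nat N * c) \<partial>lebesgue)"
      unfolding divide_ennreal_def inv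
      by (intro nn_integral_cong) (auto simp: indicator_def mult_ac)
    then show ?thesis unfolding block_integral_def by (simp add: nn_integral_divide)
  qed
  ultimately have "block_integral N F n / (of_nat N * c) \<le> 1" by simp
  moreover have "0 < of_nat N * c" "of_nat N * c < \<infinity>"
    using c N by (auto simp: ennreal_zero_less_mult_iff ennreal_mult_less_top of_nat_less_top)
  then have "block_integral N F n = block_integral N F n / (of_nat N * c) * (of_nat N * c)"
    using N c by (simp add: ennreal_divide_times ennreal_divide_self)
  ultimately show ?thesis
    using mult_right_mono[of "block_integral N F n / (of_nat N * c)" 1 "of_nat N * c"] by simp
qed

section \<open>From the Wiener norm to sequences indexed by block differences\<close>

definition unit_sup :: "(real \<Rightarrow> real) \<Rightarrow> int \<Rightarrow> ennreal" where
  "unit_sup h k = (SUP x\<in>{0..<1}. ennreal \<bar>h (real_of_int k + x)\<bar>)"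

lemma mass_unit_sup: "mass (unit_sup h) \<le> wiener_norm h"
  using mass_le_infsum[of "unit_sup h"] by (simp add: wiener_norm_def unit_sup_def)

lemma le_unit_sup: "ennreal \<bar>h t\<bar> \<le> unit_sup h \<lfloor>t\<rfloor>"
proof -
  have "t - \<lfloor>t\<rfloor> \<in> {0..<1}" by (simp add: floor_correct) linarith
  from SUP_upper[OF this, of "\<lambda>x. ennreal \<bar>h (real_of_int \<lfloor>t\<rfloor> + x)\<bar>"]
  show ?thesis by (simp add: unit_sup_def)
qed

lemma nn_integral_le_wiener_norm:
  assumes [measurable]: "h \<in> borel_measurable borel"
  shows "(\<integral>\<^sup>+t. ennreal \<bar>h t\<bar> \<partial>lebesgue) \<le> wiener_norm h"
proof -
  have "(\<integral>\<^sup>+t. ennreal \<bar>h t\<bar> \<partial>lebesgue) \<le> (\<integral>\<^sup>+t. unit_sup h (block 1 t) \<partial>lebesgue)"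
    using le_unit_sup[of h] by (intro nn_integral_mono) (simp add: block_def)
  also have "\<dots> = (\<integral>\<^sup>+m. (\<integral>\<^sup>+y. indicator {m} (block 1 y) * unit_sup h m \<partial>lebesgue) \<partial>count_space UNIV)"
    by (rule nn_integral_blocks) auto
  also have "\<dots> = mass (unit_sup h)"
    unfolding mass_def by (intro nn_integral_cong) (simp add: nn_integral_multc nn_integral_block[of 1, simplified])
  finally show ?thesis using mass_unit_sup by (rule order_trans)
qed

text \<open>If the block indices of \<open>x\<close> and \<open>y\<close> differ by
  \<open>j\<close>, then \<open>x - y\<close> lies strictly between \<open>N * (j - 1)\<close> and
  \<open>N * (j + 1)\<close>; hence a window of two block lengths.\<close>

definition block_sup :: "(real \<Rightarrow> real) \<Rightarrow> nat \<Rightarrow> int \<Rightarrow> ennreal" where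
  "block_sup h N j = (SUP t\<in>{real N * (j - 1)..real N * (j + 1)}. ennreal \<bar>h t\<bar>)"

lemma le_block_sup:
  assumes "0 < N"
  shows "ennreal \<bar>h (x - y)\<bar> \<le> block_sup h N (block N x - block N y)"
  unfolding block_sup_def
proof (rule SUP_upper)
  have "real N * block N x \<le> x" "x < real N * (block N x + 1)"
    "real N * block N y \<le> y" "y < real N * (block N y + 1)"
    using assms block_eq_iff[of N x "block N x"] block_eq_iff[of N y "block N y"] by auto
  then show "x - y \<in> {real N * (block N x - block N y - 1)..real N * (block N x - block N y + 1)}"
    by (simp add: algebra_simps)
qed

text \<open>Each window is covered by the 2N+1 unit intervals with indices
  \<open>int N * j + i\<close>, where \<open>i\<close> runs from -N to N. For fixed \<open>i\<close>
  these indices are distinct as \<open>j\<close> varies, so summing over \<open>j\<close> costs at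
  most one Wiener norm per \<open>i\<close>.\<close>

lemma mass_block_sup:
  assumes N: "0 < N" and h: "wiener_norm h < \<infinity>"
  shows "mass (block_sup h N) < \<infinity>"
proof -
  have le: "block_sup h N j \<le> (\<Sum>i\<in>{- int N..int N}. unit_sup h (int N * j + i))" for j
    unfolding block_sup_def
  proof (rule SUP_least)
    fix t assume t: "t \<in> {real N * (j - 1)..real N * (j + 1)}"
    define i where "i = \<lfloor>t\<rfloor> - int N * j"
    have "real_of_int (int N * (j - 1)) \<le> t" "t \<le> real_of_int (int N * (j + 1))" using t by simp_all
    then have "int N * (j - 1) \<le> \<lfloor>t\<rfloor>" "\<lfloor>t\<rfloor> \<le> int N * (j + 1)"
      by (simp_all only: le_floor_iff floor_le_iff)
    then have i: "i \<in> {- int N..int N}" by (simp add: i_def algebra_simps)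
    have "ennreal \<bar>h t\<bar> \<le> unit_sup h (int N * j + i)"
      using le_unit_sup[of h t] by (simp add: i_def)
    also have "\<dots> \<le> (\<Sum>i\<in>{- int N..int N}. unit_sup h (int N * j + i))"
      using i by (intro member_le_sum) auto
    finally show "ennreal \<bar>h t\<bar> \<le> \<dots>" .
  qed
  have "mass (block_sup h N) \<le> (\<Sum>i\<in>{- int N..int N}. mass (\<lambda>j. unit_sup h (int N * j + i)))"
    unfolding mass_sum[symmetric] unfolding mass_def using le by (intro nn_integral_mono) auto
  also have "\<dots> \<le> (\<Sum>i\<in>{- int N..int N}. wiener_norm h)"
    using N by (intro sum_mono order_trans[OF mass_compose_inj mass_unit_sup]) (auto intro!: injI)
  also have "\<dots> < \<infinity>"
    using h by (simp add: ennreal_mult_less_top of_nat_less_top)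
  finally show ?thesis .
qed

lemma nn_integral_kernel_le_conv:
  assumes N: "0 < N" and [measurable]: "h \<in> borel_measurable borel" "F \<in> borel_measurable lebesgue"
  shows "(\<integral>\<^sup>+y. ennreal \<bar>h (x - y)\<bar> * F y \<partial>lebesgue) \<le> conv (block_sup h N) (block_integral N F) (block N x)"
proof -
  have "(\<integral>\<^sup>+y. ennreal \<bar>h (x - y)\<bar> * F y \<partial>lebesgue) \<le> (\<integral>\<^sup>+y. block_sup h N (block N x - block N y) * F y \<partial>lebesgue)"
    using N by (intro nn_integral_mono mult_right_mono le_block_sup) auto
  also have "\<dots> = (\<integral>\<^sup>+m. (\<integral>\<^sup>+y. indicator {m} (block N y) * (block_sup h N (block N x - m) * F y) \<partial>lebesgue) \<partial>count_space UNIV)"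
    by (rule nn_integral_blocks) auto
  also have "\<dots> = conv (block_sup h N) (block_integral N F) (block N x)"
    unfolding conv_def block_integral_def
    by (intro nn_integral_cong, subst nn_integral_cmult[symmetric]) (auto simp: mult_ac)
  finally show ?thesis .
qed

text \<open>Reads a convolution of block integrals as an integral operator with kernel
  \<open>w (n - block N y)\<close>, which brings it within reach of Schur's test.\<close>

lemma conv_block_integral_eq:
  assumes [measurable]: "F \<in> borel_measurable lebesgue"
  shows "conv w (block_integral N F) n = (\<integral>\<^sup>+y. w (n - block N y) * F y \<partial>lebesgue)"
proof -
  have "(\<integral>\<^sup>+y. w (n - block N y) * F y \<partial>lebesgue)
      = (\<integral>\<^sup>+m. (\<integral>\<^sup>+y. indicator {m} (block N y) * (w (n - m) * F y) \<partial>lebesgue) \<partial>count_space UNIV)"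
    by (rule nn_integral_blocks) auto
  also have "\<dots> = conv w (block_integral N F) n"
    unfolding conv_def block_integral_def
    by (intro nn_integral_cong, subst nn_integral_cmult[symmetric]) (auto simp: mult_ac)
  finally show ?thesis by simp
qed

lemma nn_integral_mass_block:
  assumes N: "0 < N"
  shows "(\<integral>\<^sup>+y. w (n - block N y) \<partial>lebesgue) = of_nat N * mass w"
    and "(\<integral>\<^sup>+x. w (block N x - n) \<partial>lebesgue) = of_nat N * mass w"
proof -
  have *: "(\<integral>\<^sup>+y. v (block N y) \<partial>lebesgue) = of_nat N * mass v" for v
  proof -
    have "(\<integral>\<^sup>+y. v (block N y) \<partial>lebesgue)
        = (\<integral>\<^sup>+m. (\<integral>\<^sup>+y. indicator {m} (block N y) * v m \<partial>lebesgue) \<partial>count_space UNIV)"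
      by (rule nn_integral_blocks) auto
    also have "\<dots> = (\<integral>\<^sup>+m. of_nat N * v m \<partial>count_space UNIV)"
      using N by (intro nn_integral_cong) (simp add: nn_integral_multc nn_integral_block)
    finally show ?thesis by (simp add: nn_integral_cmult mass_def)
  qed
  show "(\<integral>\<^sup>+y. w (n - block N y) \<partial>lebesgue) = of_nat N * mass w"
    using *[of "\<lambda>m. w (n - m)"] by (simp add: mass_def nn_integral_int_shift(3))
  show "(\<integral>\<^sup>+x. w (block N x - n) \<partial>lebesgue) = of_nat N * mass w"
    using *[of "\<lambda>m. w (m - n)"] by (simp add: mass_def nn_integral_int_shift(2))
qed

section \<open>The commutator with a cutoff\<close>

text \<open>The majorant of |psi(x) - psi(y)| |h(x-y)| at \<open>t = x - y\<close>, for a function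
  psi with values in [0,1] and Lipschitz constant 1/N.\<close>

definition tail_kernel :: "(real \<Rightarrow> real) \<Rightarrow> nat \<Rightarrow> real \<Rightarrow> real" where
  "tail_kernel h N t = min 1 (\<bar>t\<bar> / real N) * \<bar>h t\<bar>"

lemma tail_kernel_nonneg: "0 \<le> tail_kernel h N t"
  by (simp add: tail_kernel_def)

lemma measurable_tail_kernel [measurable]:
  "h \<in> borel_measurable borel \<Longrightarrow> tail_kernel h N \<in> borel_measurable borel"
  unfolding tail_kernel_def[abs_def] by measurable

lemma tail_kernel_tendsto:
  assumes [measurable]: "h \<in> borel_measurable borel" and fin: "(\<integral>\<^sup>+t. ennreal \<bar>h t\<bar> \<partial>lebesgue) < \<infinity>"
  shows "(\<lambda>N. \<integral>\<^sup>+t. ennreal (tail_kernel h N t) \<partial>lebesgue) \<longlonglongrightarrow> 0"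
proof -
  have [measurable]: "h \<in> borel_measurable lebesgue" "\<And>N. tail_kernel h N \<in> borel_measurable lebesgue"
    by (simp_all add: measurable_completion)
  have "(\<lambda>N. \<integral>\<^sup>+t. ennreal (tail_kernel h N t) \<partial>lebesgue) \<longlonglongrightarrow> (\<integral>\<^sup>+t. 0 \<partial>(lebesgue :: real measure))"
  proof (rule nn_integral_dominated_convergence[where w="\<lambda>t. ennreal \<bar>h t\<bar>"])
    show "AE t in lebesgue. ennreal (tail_kernel h N t) \<le> ennreal \<bar>h t\<bar>" for N
      unfolding tail_kernel_def by (intro AE_I2 ennreal_leI mult_left_le_one_le) auto
    have "(\<lambda>N. tail_kernel h N t) \<longlonglongrightarrow> 0" for t
    proof (rule tendsto_sandwich[OF always_eventually always_eventually tendsto_const])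
      show "\<forall>N. 0 \<le> tail_kernel h N t" by (simp add: tail_kernel_nonneg)
      show "\<forall>N. tail_kernel h N t \<le> \<bar>t\<bar> / real N * \<bar>h t\<bar>"
        unfolding tail_kernel_def by (intro allI mult_right_mono) auto
      have "(\<lambda>N. \<bar>t\<bar> / real N * \<bar>h t\<bar>) \<longlonglongrightarrow> 0 * \<bar>h t\<bar>"
        by (intro tendsto_mult tendsto_const lim_const_over_n)
      then show "(\<lambda>N. \<bar>t\<bar> / real N * \<bar>h t\<bar>) \<longlonglongrightarrow> 0" by simp
    qed
    then have "(\<lambda>N. ennreal (tail_kernel h N t)) \<longlonglongrightarrow> ennreal 0" for t
      by (rule tendsto_ennrealI)
    then show "AE t in lebesgue. (\<lambda>N. ennreal (tail_kernel h N t)) \<longlonglongrightarrow> 0"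
      by simp
  qed (use fin in auto)
  then show ?thesis by simp
qed

text \<open>Here \<open>j\<close> stands for \<open>n - block N y\<close> and \<open>t\<close> for
  \<open>x - y\<close>. Using \<open>tail_kernel\<close> for every \<open>j\<close> would give a
  divergent sum over \<open>j\<close>; the case distinction leaves a bounded number of nonzero terms
  for each \<open>t\<close>.\<close>

definition commutator_kernel :: "(real \<Rightarrow> real) \<Rightarrow> nat \<Rightarrow> int \<Rightarrow> real \<Rightarrow> real" where
  "commutator_kernel h N j t =
     (if \<bar>j\<bar> \<le> 3 \<or> \<bar>t / real N - real_of_int j\<bar> < 2 then tail_kernel h N t else 0)"

lemma measurable_commutator_kernel [measurable]:
  assumes [measurable]: "h \<in> borel_measurable borel"
  shows "commutator_kernel h N j \<in> borel_measurable borel"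
  unfolding commutator_kernel_def[abs_def] by measurable

definition commutator_mass :: "(real \<Rightarrow> real) \<Rightarrow> nat \<Rightarrow> int \<Rightarrow> ennreal" where
  "commutator_mass h N j = (\<integral>\<^sup>+t. ennreal (commutator_kernel h N j t) \<partial>lebesgue)"

lemma mass_commutator_mass:
  assumes [measurable]: "h \<in> borel_measurable borel"
  shows "mass (commutator_mass h N) \<le> 12 * (\<integral>\<^sup>+t. ennreal (tail_kernel h N t) \<partial>lebesgue)"
proof -
  have [measurable]: "tail_kernel h N \<in> borel_measurable lebesgue"
      "\<And>j. commutator_kernel h N j \<in> borel_measurable lebesgue"
    by (simp_all add: measurable_completion)
  have *: "(\<integral>\<^sup>+j. ennreal (commutator_kernel h N j t) \<partial>count_space UNIV) \<le> 12 * ennreal (tail_kernel h N t)" for t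
  proof -
    \<comment> \<open>At most 7 + 5 = 12 integers, the origin of the factor 12.\<close>
    define J where "J = {-3..3} \<union> {\<lfloor>t / real N\<rfloor> - 2..\<lfloor>t / real N\<rfloor> + 2}"
    have "ennreal (commutator_kernel h N j t) \<le> ennreal (tail_kernel h N t) * indicator J j" for j
    proof (cases "j \<in> J")
      case False
      then have "\<not> \<bar>j\<bar> \<le> 3" "j < \<lfloor>t / real N\<rfloor> - 2 \<or> \<lfloor>t / real N\<rfloor> + 2 < j"
        by (auto simp: J_def)
      then have "\<not> (\<bar>j\<bar> \<le> 3 \<or> \<bar>t / real N - real_of_int j\<bar> < 2)" by linarith
      then show ?thesis by (simp add: commutator_kernel_def)
    qed (simp add: commutator_kernel_def tail_kernel_nonneg)
    then have "(\<integral>\<^sup>+j. ennreal (commutator_kernel h N j t) \<partial>count_space UNIV)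
        \<le> (\<integral>\<^sup>+j. ennreal (tail_kernel h N t) * indicator J j \<partial>count_space UNIV)"
      by (intro nn_integral_mono)
    also have "\<dots> = ennreal (tail_kernel h N t) * of_nat (card J)"
      by (simp add: nn_integral_cmult_indicator J_def)
    also have "\<dots> \<le> ennreal (tail_kernel h N t) * of_nat 12"
    proof (intro mult_left_mono of_nat_mono)
      have "card J \<le> card {-3..3::int} + card {\<lfloor>t / real N\<rfloor> - 2..\<lfloor>t / real N\<rfloor> + 2}"
        unfolding J_def by (rule card_Un_le)
      then show "card J \<le> 12" by simp
    qed simp
    finally show ?thesis by (simp add: mult.commute)
  qed
  have "mass (commutator_mass h N) = (\<integral>\<^sup>+t. \<integral>\<^sup>+j. ennreal (commutator_kernel h N j t) \<partial>count_space UNIV \<partial>lebesgue)"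
    unfolding mass_def commutator_mass_def by (rule nn_integral_count_space_nn_integral[symmetric]) auto
  also have "\<dots> \<le> (\<integral>\<^sup>+t. 12 * ennreal (tail_kernel h N t) \<partial>lebesgue)"
    by (intro nn_integral_mono *)
  finally show ?thesis by (simp add: nn_integral_cmult)
qed

text \<open>In the coordinate \<open>s = x / N - n\<close> this is a trapezoid: 1 on [0,1], which is
  the \<open>n\<close>th block, 0 outside (-1,2), with slopes 1 and -1 between. In \<open>x\<close>
  the Lipschitz constant is 1/N.\<close>

definition cutoff :: "nat \<Rightarrow> int \<Rightarrow> real \<Rightarrow> real" where
  "cutoff N n x = max 0 (min 1 (min (x / real N - real_of_int n + 1) (2 - (x / real N - real_of_int n))))"

lemma measurable_cutoff [measurable]: "cutoff N n \<in> borel_measurable borel"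
  unfolding cutoff_def[abs_def] by measurable

lemma cutoff_bounds: "0 \<le> cutoff N n x" "cutoff N n x \<le> 1"
  by (auto simp: cutoff_def)

lemma block_bounds: "of_int (block N x) \<le> x / real N" "x / real N < of_int (block N x) + 1"
  by (simp_all add: block_def)

lemma cutoff_eq_1: "block N x = n \<Longrightarrow> cutoff N n x = 1"
  using block_bounds[where N=N and x=x] by (simp add: cutoff_def)

lemma cutoff_eq_0: "block N x \<notin> {n - 1..n + 1} \<Longrightarrow> cutoff N n x = 0"
  using block_bounds[where N=N and x=x] unfolding cutoff_def atLeastAtMost_iff by (simp split: split_min split_max) linarith

text \<open>If \<open>y\<close> is far from the \<open>n\<close>th block, then \<open>cutoff N n y = 0\<close>, and \<open>cutoff N n x\<close> vanishes too unless
  \<open>x - y\<close> is within \<open>2 N\<close> of \<open>(n - block N y) * N\<close>.\<close>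

lemma commutator_bound:
  assumes N: "0 < N"
  shows "\<bar>cutoff N n y - cutoff N n x\<bar> * \<bar>h (x - y)\<bar> \<le> commutator_kernel h N (n - block N y) (x - y)"
proof -
  define s where "s = x / real N - real_of_int n"
  define t where "t = y / real N - real_of_int n"
  have st: "(x - y) / real N = s - t" by (simp add: s_def t_def diff_divide_distrib)
  have abs: "\<bar>x - y\<bar> / real N = \<bar>s - t\<bar>" using st by (metis abs_divide abs_of_nat)
  have cut: "cutoff N n x = max 0 (min 1 (min (s + 1) (2 - s)))" "cutoff N n y = max 0 (min 1 (min (t + 1) (2 - t)))"
    by (simp_all add: cutoff_def s_def t_def)
  define j where "j = n - block N y"
  have tj: "- real_of_int j \<le> t" "t < 1 - real_of_int j"
    using block_bounds[where N=N and x=y] by (simp_all add: t_def j_def)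
  have le: "\<bar>cutoff N n y - cutoff N n x\<bar> \<le> min 1 \<bar>s - t\<bar>"
    unfolding cut by (simp add: min_def max_def abs_if)
  show ?thesis
  proof (cases "\<bar>j\<bar> \<le> 3 \<or> \<bar>(x - y) / real N - real_of_int j\<bar> < 2")
    case True
    then have "commutator_kernel h N j (x - y) = min 1 \<bar>s - t\<bar> * \<bar>h (x - y)\<bar>"
      by (simp add: commutator_kernel_def tail_kernel_def abs)
    then show ?thesis using le by (simp add: j_def[symmetric] mult_right_mono)
  next
    case False
    then have j: "j \<ge> 4 \<or> j \<le> -4" and d: "2 \<le> \<bar>s - t - real_of_int j\<bar>"
      by (auto simp: st)
    have "t < - 2 \<or> 3 \<le> t" using j tj by linarith
    then have "cutoff N n y = 0" unfolding cut by linarith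
    \<comment> \<open>Since \<open>t + j\<close> lies in [0,1), a point \<open>s\<close> at distance
      at least 2 from it is outside (-1,2), where the trapezoid lives.\<close>
    moreover have "s \<le> - 1 \<or> 2 \<le> s" using d tj by linarith
    then have "cutoff N n x = 0" unfolding cut by linarith
    ultimately show ?thesis
      by (simp add: commutator_kernel_def tail_kernel_nonneg)
  qed
qed

section \<open>Integral operators with amalgam kernels\<close>

text \<open>The sharp bound is \<open>c\<close> times the 1/q-th power of the measure of
  \<open>E\<close>. Because \<open>k\<close> is at least 1, the bound \<open>k * c\<close> is valid
  for all exponents together: by convexity the modular at \<open>1 / k\<close> is at most
  \<open>1 / k\<close>.\<close>

lemma Lp_le_bounded_support:
  assumes q: "1 \<le> q" and E [measurable]: "E \<in> sets lebesgue" and k: "emeasure lebesgue E \<le> k" "1 \<le> k" "k < \<infinity>"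
    and c: "0 < c" "c < \<infinity>" and F: "\<And>x. F x \<le> c * indicator E x"
  shows "Lp_le q F (k * c)"
proof -
  have k0: "k \<noteq> 0" using k by auto
  have inv: "inverse (k * c) = inverse k * inverse c"
    using k c by (intro ennreal_inverse_mult) auto
  have cc: "c * inverse c = 1"
    using c ennreal_divide_self[of c] by (auto simp: divide_ennreal_def)
  have ik: "inverse k \<le> 1"
    using inverse_antimono_ennreal[OF k(2)] by simp
  have "modular q (F x / (k * c)) \<le> inverse k * indicator E x" for x
  proof -
    have "F x / (k * c) \<le> c * indicator E x / (k * c)"
      by (intro divide_right_mono_ennreal F)
    also have "\<dots> = (c * inverse c) * (inverse k * indicator E x)"
      unfolding divide_ennreal_def inv by (simp only: mult_ac)
    finally have "F x / (k * c) \<le> inverse k * indicator E x"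
      by (simp add: cc)
    then have "modular q (F x / (k * c)) \<le> modular q (inverse k * indicator E x)"
      by (rule modular_mono)
    also have "\<dots> \<le> inverse k * modular q (indicator E x)"
      using q ik by (rule modular_mult)
    also have "\<dots> \<le> inverse k * indicator E x"
      using modular_le_1_iff[OF q, of 1] by (intro mult_left_mono) (auto simp: indicator_def)
    finally show ?thesis .
  qed
  then have "(\<integral>\<^sup>+x. modular q (F x / (k * c)) \<partial>lebesgue) \<le> (\<integral>\<^sup>+x. inverse k * indicator E x \<partial>lebesgue)"
    by (intro nn_integral_mono)
  also have "\<dots> = inverse k * emeasure lebesgue E"
    by (simp add: nn_integral_cmult_indicator)
  also have "\<dots> \<le> inverse k * k" using k by (intro mult_left_mono) auto
  also have "\<dots> = 1"
    using k k0 ennreal_divide_self[of k] by (simp add: divide_ennreal_def mult.commute)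
  finally show ?thesis by (simp add: Lp_le_def)
qed

lemma emeasure_block_vimage:
  assumes "0 < N" "finite J"
  shows "emeasure lebesgue {x. block N x \<in> J} = of_nat (N * card J)" "{x. block N x \<in> J} \<in> sets lebesgue"
proof -
  have "{x \<in> space lebesgue. block N x \<in> J} \<in> sets lebesgue" by measurable
  then show J: "{x. block N x \<in> J} \<in> sets lebesgue" by simp
  have "emeasure lebesgue {x. block N x \<in> J} = (\<integral>\<^sup>+x. indicator {x. block N x \<in> J} x \<partial>lebesgue)"
    using J by (rule nn_integral_indicator[symmetric])
  also have "\<dots> = (\<integral>\<^sup>+x. indicator J (block N x - 0) \<partial>lebesgue)"
    by (intro nn_integral_cong) (simp add: indicator_def)
  also have "\<dots> = of_nat N * mass (indicator J)"
    by (rule nn_integral_mass_block(2)[OF assms(1)])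
  also have "\<dots> = of_nat (N * card J)"
    using assms(2) by (simp add: mass_def)
  finally show "emeasure lebesgue {x. block N x \<in> J} = of_nat (N * card J)" .
qed

text \<open>Puts cutoffs of a bounded function into the space where stability is assumed, whatever
  space the function came from.\<close>

lemma Lp_bounded_block:
  assumes q: "1 \<le> q" and N: "0 < N" and J: "finite J" "J \<noteq> {}" and M: "0 < M"
    and f [measurable]: "f \<in> borel_measurable lebesgue"
    and le: "\<And>x. cmod (f x) \<le> M" "\<And>x. block N x \<notin> J \<Longrightarrow> f x = 0"
  shows "f \<in> Lp q" "Lp_norm q f \<le> real (N * card J) * M"
proof -
  have "1 \<le> N * card J" using N J by (simp add: card_gt_0_iff Suc_leI)
  then have k: "1 \<le> (of_nat (N * card J) :: ennreal)" by (metis of_nat_1 of_nat_mono)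
  have "Lp_le q (\<lambda>x. ennreal (cmod (f x))) (of_nat (N * card J) * ennreal M)"
  proof (rule Lp_le_bounded_support[OF q emeasure_block_vimage(2)[OF N J(1)] _ k])
    show "ennreal (cmod (f x)) \<le> ennreal M * indicator {x. block N x \<in> J} x" for x
      using le[of x] by (auto simp: indicator_def intro: ennreal_leI)
  qed (use M emeasure_block_vimage(1)[OF N J(1)] in \<open>auto simp: of_nat_less_top ennreal_mult_less_top\<close>)
  moreover have "of_nat (N * card J) * ennreal M = ennreal (real (N * card J) * M)"
    using M by (simp add: ennreal_mult ennreal_of_nat_eq_real_of_nat)
  moreover have "0 < real (N * card J) * M"
    using N J M by (simp add: card_gt_0_iff)
  ultimately show "f \<in> Lp q" "Lp_norm q f \<le> real (N * card J) * M"
    using Lp_le_iff[OF q _ f, of "real (N * card J) * M"] by auto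
qed

text \<open>For a function that is not integrable, the Bochner integral is 0 by default, so the
  bound is trivial there.\<close>

lemma norm_integral_le_nn_integral:
  fixes f :: "'a \<Rightarrow> 'b::{banach, second_countable_topology}"
  shows "ennreal (norm (LINT x|M. f x)) \<le> (\<integral>\<^sup>+x. ennreal (norm (f x)) \<partial>M)"
  by (cases "integrable M f") (auto simp: integral_norm_bound_ennreal not_integrable_integral_eq)

text \<open>Removes the small \<open>e\<close> that was added to keep Luxemburg bounds positive;
  \<open>d\<close> collects its coefficients.\<close>

lemma ennreal_le_add_small:
  fixes a b d :: ennreal
  assumes "\<And>e. 0 < e \<Longrightarrow> a \<le> b + ennreal e * d" "d < \<infinity>"
  shows "a \<le> b"
proof (rule ennreal_le_epsilon)
  fix e :: real assume e: "0 < e"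
  obtain r where r: "d = ennreal r" "0 \<le> r" using assms(2) by (cases d) auto
  have "a \<le> b + ennreal (e / (r + 1)) * d" using e r by (intro assms) auto
  also have "ennreal (e / (r + 1)) * d = ennreal (e * r / (r + 1))"
    using e r by (simp add: ennreal_mult[symmetric])
  also have "\<dots> \<le> ennreal e"
    using e r by (intro ennreal_leI) (simp add: field_simps)
  finally show "a \<le> b + ennreal e" by (simp add: add_left_mono)
qed

lemma block_integral_le_Lp_le:
  assumes "1 \<le> q" "0 < N" "0 < c" "c < \<infinity>" and [measurable]: "f \<in> borel_measurable lebesgue"
    and "Lp_le q (\<lambda>y. ennreal (cmod (f y))) c"
  shows "block_integral N (\<lambda>y. ennreal (cmod (f y))) m \<le> of_nat N * c"
proof (rule block_integral_le[OF assms(1-4)])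
  show "Lp_le q (\<lambda>y. indicator {m} (block N y) * ennreal (cmod (f y))) c"
    using assms(6) by (rule Lp_le_mono) (auto simp: indicator_def)
qed measurable

lemma block_integral_le_bounded:
  assumes "0 < N" "\<And>x. cmod (f x) \<le> M" "0 < M"
  shows "block_integral N (\<lambda>y. ennreal (cmod (f y))) m \<le> of_nat N * ennreal M"
proof -
  have "block_integral N (\<lambda>y. ennreal (cmod (f y))) m \<le> (\<integral>\<^sup>+y. indicator {m} (block N y) * ennreal M \<partial>lebesgue)"
    unfolding block_integral_def using assms by (intro nn_integral_mono mult_left_mono ennreal_leI) auto
  also have "\<dots> = of_nat N * ennreal M"
    using assms by (simp add: nn_integral_multc nn_integral_block)
  finally show ?thesis .
qed

lemma Lp_exists_Lp_le:
  assumes "1 \<le> q" "f \<in> Lp q"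
  obtains c where "0 < c" "Lp_le q (\<lambda>y. ennreal (cmod (f y))) (ennreal c)" "f \<in> borel_measurable lebesgue"
proof -
  have "0 \<le> Lp_norm q f" by (simp add: Lp_norm_def)
  then have "0 < Lp_norm q f + 1" by simp
  moreover have "f \<in> borel_measurable lebesgue" using assms by (simp add: Lp_def)
  ultimately show ?thesis
    using assms Lp_le_iff[of q "Lp_norm q f + 1" f] by (intro that[of "Lp_norm q f + 1"]) auto
qed

lemma le_mult_if_forall_gt:
  fixes a b k :: real
  assumes "0 < k" "\<And>c. a < c \<Longrightarrow> b \<le> k * c"
  shows "b \<le> k * a"
proof -
  have "b / k \<le> a"
    by (rule dense_ge) (use assms in \<open>simp add: field_simps\<close>)
  then show ?thesis using assms(1) by (simp add: field_simps)
qed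

section \<open>The operator on L^q: integrability, boundedness, linearity\<close>

locale wiener_kernel =
  fixes K :: "real \<Rightarrow> real \<Rightarrow> complex" and h :: "real \<Rightarrow> real"
  assumes measurable_K [measurable]: "(\<lambda>(x, y). K x y) \<in> borel_measurable (borel \<Otimes>\<^sub>M borel)"
    and measurable_h [measurable]: "h \<in> borel_measurable borel"
    and K_le: "\<And>x y. cmod (K x y) \<le> h (x - y)"
    and h_fin: "wiener_norm h < \<infinity>"
begin

abbreviation T :: "(real \<Rightarrow> complex) \<Rightarrow> real \<Rightarrow> complex" where
  "T f \<equiv> integral_op K f"

lemma measurable_K_lebesgue [measurable]:
  "(\<lambda>(x, y). K x y) \<in> borel_measurable (lebesgue \<Otimes>\<^sub>M lebesgue)"
  by (rule measurable_lebesgue_pair) measurable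

lemma measurable_K_section: "K x \<in> borel_measurable lebesgue"
proof -
  have "Pair x \<in> measurable lebesgue (lebesgue \<Otimes>\<^sub>M lebesgue)"
    by (rule measurable_Pair1') simp
  from measurable_compose[OF this measurable_K_lebesgue] show ?thesis
    by (simp only: prod.case)
qed

lemma measurable_op [measurable]:
  assumes [measurable]: "f \<in> borel_measurable lebesgue"
  shows "T f \<in> borel_measurable lebesgue"
  unfolding integral_op_def[abs_def]
  by (rule sigma_finite_measure.borel_measurable_lebesgue_integral[OF sigma_finite_lebesgue])
    measurable

lemma nn_integral_op_le:
  assumes [measurable]: "f \<in> borel_measurable lebesgue"
  shows "(\<integral>\<^sup>+y. ennreal (cmod (K x y * f y)) \<partial>lebesgue) \<le> (\<integral>\<^sup>+y. ennreal \<bar>h (x - y)\<bar> * ennreal (cmod (f y)) \<partial>lebesgue)"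
proof (rule nn_integral_mono)
  fix y
  have "cmod (K x y * f y) \<le> \<bar>h (x - y)\<bar> * cmod (f y)"
    using K_le[of x y] by (simp add: norm_mult mult_right_mono)
  then show "ennreal (cmod (K x y * f y)) \<le> ennreal \<bar>h (x - y)\<bar> * ennreal (cmod (f y))"
    by (simp add: ennreal_mult[symmetric] ennreal_leI)
qed

lemma op_le:
  assumes [measurable]: "f \<in> borel_measurable lebesgue"
  shows "ennreal (cmod (T f x)) \<le> (\<integral>\<^sup>+y. ennreal \<bar>h (x - y)\<bar> * ennreal (cmod (f y)) \<partial>lebesgue)"
  unfolding integral_op_def using norm_integral_le_nn_integral nn_integral_op_le[OF assms]
  by (rule order_trans)

lemma op_le_conv:
  assumes [measurable]: "f \<in> borel_measurable lebesgue" and N: "0 < N"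
  shows "ennreal (cmod (T f x)) \<le> conv (block_sup h N) (block_integral N (\<lambda>y. ennreal (cmod (f y)))) (block N x)"
  by (rule order_trans[OF op_le nn_integral_kernel_le_conv]) (use N in measurable)

text \<open>Uniformly bounded block integrals are the common ground of bounded functions and of all
  L^q. Integrability holds at every \<open>x\<close>, not just almost every \<open>x\<close>, so
  identities for \<open>T\<close> may be used pointwise.\<close>

lemma integrable_K:
  assumes [measurable]: "f \<in> borel_measurable lebesgue" and N: "0 < N"
    and bdd: "\<And>m. block_integral N (\<lambda>y. ennreal (cmod (f y))) m \<le> M" "M < \<infinity>"
  shows "integrable lebesgue (\<lambda>y. K x y * f y)"
proof (rule integrableI_bounded)
  have "(\<integral>\<^sup>+y. ennreal (cmod (K x y * f y)) \<partial>lebesgue)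
      \<le> conv (block_sup h N) (block_integral N (\<lambda>y. ennreal (cmod (f y)))) (block N x)"
    by (rule order_trans[OF nn_integral_op_le nn_integral_kernel_le_conv]) (use N in measurable)
  also have "\<dots> \<le> mass (block_sup h N) * M"
    using bdd(1) by (rule conv_le_mass)
  also have "\<dots> < \<infinity>"
    using mass_block_sup[OF N h_fin] bdd(2) by (simp add: ennreal_mult_less_top)
  finally show "(\<integral>\<^sup>+y. ennreal (cmod (K x y * f y)) \<partial>lebesgue) < \<infinity>" .
qed (intro borel_measurable_times measurable_K_section assms(1))

lemma integrable_K_bounded:
  assumes "f \<in> borel_measurable lebesgue" "\<And>x. cmod (f x) \<le> M" "0 < M"
  shows "integrable lebesgue (\<lambda>y. K x y * f y)"
  by (rule integrable_K[OF assms(1) zero_less_one block_integral_le_bounded[OF zero_less_one assms(2,3)]])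
    (auto simp: ennreal_mult_less_top)

lemma integrable_K_Lp:
  assumes q: "1 \<le> q" and f: "f \<in> Lp q"
  shows "integrable lebesgue (\<lambda>y. K x y * f y)"
proof -
  obtain c where c: "0 < c" "Lp_le q (\<lambda>y. ennreal (cmod (f y))) (ennreal c)" "f \<in> borel_measurable lebesgue"
    using Lp_exists_Lp_le[OF assms] by blast
  show ?thesis
    by (rule integrable_K[OF c(3) zero_less_one block_integral_le_Lp_le[OF q zero_less_one _ _ c(3,2)]])
      (use c in \<open>auto simp: ennreal_mult_less_top\<close>)
qed

text \<open>Schur's test for the kernel |h(x-y)|, whose row and column integrals are at most the
  Wiener norm. The added 1 keeps the constant positive when \<open>h\<close> vanishes.\<close>

lemma Lp_le_op:
  assumes q: "1 \<le> q" and c: "0 < c" "c < \<infinity>" and f [measurable]: "f \<in> borel_measurable lebesgue"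
    and le: "Lp_le q (\<lambda>y. ennreal (cmod (f y))) c"
  shows "Lp_le q (\<lambda>y. ennreal (cmod (T f y))) ((wiener_norm h + 1) * c)"
proof -
  let ?S = "wiener_norm h + 1"
  have [measurable]: "(\<lambda>t. ennreal \<bar>h t\<bar>) \<in> borel_measurable borel" by measurable
  have "(\<integral>\<^sup>+t. ennreal \<bar>h t\<bar> \<partial>lebesgue) \<le> wiener_norm h + 1"
    by (rule order_trans[OF nn_integral_le_wiener_norm]) (auto simp: add_increasing2)
  then have S: "(\<integral>\<^sup>+y. ennreal \<bar>h (x - y)\<bar> \<partial>lebesgue) \<le> wiener_norm h + 1"
    "(\<integral>\<^sup>+x. ennreal \<bar>h (x - y)\<bar> \<partial>lebesgue) \<le> wiener_norm h + 1" for x y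
    using nn_integral_lebesgue_translate[of "\<lambda>t. ennreal \<bar>h t\<bar>"] by simp_all
  have k: "(\<lambda>(x, y). ennreal \<bar>h (x - y)\<bar>) \<in> borel_measurable (lebesgue \<Otimes>\<^sub>M lebesgue)"
    by (rule measurable_lebesgue_pair) measurable
  have "0 < ?S" "?S < \<infinity>" using h_fin by (auto intro: add_nonneg_pos)
  then have "Lp_le q (\<lambda>x. \<integral>\<^sup>+y. ennreal \<bar>h (x - y)\<bar> * ennreal (cmod (f y)) \<partial>lebesgue) (?S * c)"
    by (intro Lp_le_schur[OF q k _ c _ _ S le]) measurable
  then show ?thesis
    by (rule Lp_le_mono) (auto intro: op_le)
qed

lemma Lp_le_id_plus_op:
  assumes q: "1 \<le> q" and c: "0 < c" and f [measurable]: "f \<in> borel_measurable lebesgue"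
    and le: "Lp_le q (\<lambda>y. ennreal (cmod (f y))) (ennreal c)"
  shows "Lp_le q (\<lambda>y. ennreal (cmod (f y + T f y))) (ennreal ((2 + enn2real (wiener_norm h)) * c))"
proof (rule Lp_le_mono[OF Lp_le_add[OF q _ _ _ _ _ _ le Lp_le_op[OF q _ _ f le]]])
  show "ennreal (cmod (f x + T f x)) \<le> ennreal (cmod (f x)) + ennreal (cmod (T f x))" for x
    by (simp add: norm_triangle_ineq flip: ennreal_plus)
  obtain w where w: "wiener_norm h = ennreal w" "0 \<le> w" using h_fin by (cases "wiener_norm h") auto
  have "(wiener_norm h + 1) * ennreal c = ennreal ((w + 1) * c)"
    unfolding w using w c by (simp add: ennreal_mult' ennreal_plus)
  then show "ennreal c + (wiener_norm h + 1) * ennreal c \<le> ennreal ((2 + enn2real (wiener_norm h)) * c)"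
    using w c by (simp add: ennreal_plus[symmetric] algebra_simps del: ennreal_plus)
  show "0 < (wiener_norm h + 1) * ennreal c" "(wiener_norm h + 1) * ennreal c < \<infinity>"
    using h_fin c by (auto simp: ennreal_zero_less_mult_iff ennreal_mult_less_top add_nonneg_pos)
qed (use c in auto)

lemma bounded_id_plus_op:
  assumes q: "1 \<le> q"
  shows "bounded_op_Lp q (\<lambda>f x. f x + T f x)"
    and "f \<in> Lp q \<Longrightarrow> Lp_norm q (\<lambda>x. f x + T f x) \<le> (2 + enn2real (wiener_norm h)) * Lp_norm q f"
proof -
  have *: "(\<lambda>x. f x + T f x) \<in> Lp q \<and> Lp_norm q (\<lambda>x. f x + T f x) \<le> (2 + enn2real (wiener_norm h)) * c"
    if f: "f \<in> Lp q" and c: "Lp_norm q f < c" for f c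
  proof -
    have [measurable]: "f \<in> borel_measurable lebesgue" using f by (simp add: Lp_def)
    have "0 \<le> Lp_norm q f" by (simp add: Lp_norm_def)
    then have c0: "0 < c" using c by simp
    then have "Lp_le q (\<lambda>y. ennreal (cmod (f y))) (ennreal c)"
      using f c by (subst Lp_le_iff[OF q]) auto
    then have "Lp_le q (\<lambda>y. ennreal (cmod (f y + T f y))) (ennreal ((2 + enn2real (wiener_norm h)) * c))"
      by (intro Lp_le_id_plus_op[OF q c0]) measurable
    moreover have "0 < (2 + enn2real (wiener_norm h)) * c"
      using c0 by (intro mult_pos_pos add_pos_nonneg) auto
    ultimately show ?thesis
      by (subst (asm) Lp_le_iff[OF q]) auto
  qed
  show norm: "Lp_norm q (\<lambda>x. f x + T f x) \<le> (2 + enn2real (wiener_norm h)) * Lp_norm q f" if "f \<in> Lp q" for f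
  proof (rule le_mult_if_forall_gt)
    show "0 < 2 + enn2real (wiener_norm h)" by (intro add_pos_nonneg) auto
    show "Lp_norm q (\<lambda>x. f x + T f x) \<le> (2 + enn2real (wiener_norm h)) * c" if "Lp_norm q f < c" for c
      using *[OF \<open>f \<in> Lp q\<close> that] by (rule conjunct2)
  qed
  have "(\<lambda>x. f x + T f x) \<in> Lp q" if "f \<in> Lp q" for f
    using *[OF that, of "Lp_norm q f + 1"] by simp
  \<comment> \<open>Linearity holds at every point, since both integrals converge there.\<close>
  moreover have "(a * f x + b * g x) + T (\<lambda>y. a * f y + b * g y) x = a * (f x + T f x) + b * (g x + T g x)"
    if "f \<in> Lp q" "g \<in> Lp q" for f g a b x
  proof -
    have "T (\<lambda>y. a * f y + b * g y) x = (LINT y|lebesgue. a * (K x y * f y) + b * (K x y * g y))"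
      unfolding integral_op_def by (simp add: algebra_simps)
    also have "\<dots> = a * T f x + b * T g x"
      unfolding integral_op_def
      using integrable_K_Lp[OF q that(1), of x] integrable_K_Lp[OF q that(2), of x]
      by (subst Bochner_Integration.integral_add) auto
    finally show ?thesis by (simp add: algebra_simps)
  qed
  ultimately show "bounded_op_Lp q (\<lambda>f x. f x + T f x)"
    unfolding bounded_op_Lp_def using norm
    by (intro conjI ballI allI AE_I2 exI[of _ "2 + enn2real (wiener_norm h)"]) auto
qed

section \<open>Localising the stability inequality\<close>

lemma cutoff_commutator_le:
  assumes N: "0 < N" and u [measurable]: "u \<in> borel_measurable lebesgue" and M: "\<And>x. cmod (u x) \<le> M" "0 < M"
  shows "ennreal (cmod (of_real (cutoff N n x) * u x + T (\<lambda>y. of_real (cutoff N n y) * u y) x))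
    \<le> ennreal (cutoff N n x * cmod (u x + T u x)) +
      (\<integral>\<^sup>+y. ennreal (commutator_kernel h N (n - block N y) (x - y)) * ennreal (cmod (u y)) \<partial>lebesgue)"
proof -
  let ?c = "cutoff N n"
  define f where "f = (\<lambda>y. complex_of_real (?c y) * u y)"
  have c_leb [measurable]: "?c \<in> borel_measurable lebesgue" by (simp add: measurable_completion)
  have f [measurable]: "f \<in> borel_measurable lebesgue" unfolding f_def by measurable
  have "cmod (f y) \<le> M" for y
  proof -
    have "cmod (f y) \<le> 1 * M"
      unfolding f_def norm_mult using cutoff_bounds[of N n y] M(1)[of y] by (intro mult_mono) auto
    then show ?thesis by simp
  qed
  then have int: "integrable lebesgue (\<lambda>y. K x y * f y)" "integrable lebesgue (\<lambda>y. K x y * u y)"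
    using integrable_K_bounded[OF f _ M(2)] integrable_K_bounded[OF u M] by auto
  \<comment> \<open>With psi the cutoff, (I+T)(psi u) = psi (I+T)u + [T, psi]u, and the commutator
    has the kernel (psi(y) - psi(x)) K(x,y). Splitting the integral is legitimate because
    \<open>u\<close> is bounded.\<close>
  have eq: "f x + T f x = of_real (?c x) * (u x + T u x) + (LINT y|lebesgue. of_real (?c y - ?c x) * (K x y * u y))"
  proof -
    have "T f x - of_real (?c x) * T u x = (LINT y|lebesgue. K x y * f y - of_real (?c x) * (K x y * u y))"
      unfolding integral_op_def using int by (subst Bochner_Integration.integral_diff) auto
    also have "\<dots> = (LINT y|lebesgue. of_real (?c y - ?c x) * (K x y * u y))"
      by (intro Bochner_Integration.integral_cong) (auto simp: f_def algebra_simps)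
    finally show ?thesis by (simp add: f_def algebra_simps)
  qed
  have "ennreal (cmod (LINT y|lebesgue. of_real (?c y - ?c x) * (K x y * u y)))
      \<le> (\<integral>\<^sup>+y. ennreal (cmod (of_real (?c y - ?c x) * (K x y * u y))) \<partial>lebesgue)"
    by (rule norm_integral_le_nn_integral)
  also have "\<dots> \<le> (\<integral>\<^sup>+y. ennreal (commutator_kernel h N (n - block N y) (x - y)) * ennreal (cmod (u y)) \<partial>lebesgue)"
  proof (rule nn_integral_mono)
    fix y
    have "\<bar>?c y - ?c x\<bar> * cmod (K x y) \<le> \<bar>?c y - ?c x\<bar> * \<bar>h (x - y)\<bar>"
      using K_le[of x y] by (intro mult_left_mono) auto
    also have "\<dots> \<le> commutator_kernel h N (n - block N y) (x - y)"
      by (rule commutator_bound[OF N])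
    finally have *: "\<bar>?c y - ?c x\<bar> * cmod (K x y) \<le> commutator_kernel h N (n - block N y) (x - y)" .
    then have "0 \<le> commutator_kernel h N (n - block N y) (x - y)"
      by (rule order_trans[rotated]) simp
    moreover have "cmod (of_real (?c y - ?c x) * (K x y * u y)) = \<bar>?c y - ?c x\<bar> * cmod (K x y) * cmod (u y)"
      by (simp only: norm_mult norm_of_real mult.assoc)
    ultimately show "ennreal (cmod (of_real (?c y - ?c x) * (K x y * u y)))
        \<le> ennreal (commutator_kernel h N (n - block N y) (x - y)) * ennreal (cmod (u y))"
      using mult_right_mono[OF *, of "cmod (u y)"] by (simp add: ennreal_mult[symmetric] ennreal_leI)
  qed
  finally have 1: "ennreal (cmod (LINT y|lebesgue. of_real (?c y - ?c x) * (K x y * u y)))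
      \<le> (\<integral>\<^sup>+y. ennreal (commutator_kernel h N (n - block N y) (x - y)) * ennreal (cmod (u y)) \<partial>lebesgue)" .
  have "cmod (f x + T f x) \<le> cmod (of_real (?c x) * (u x + T u x)) + cmod (LINT y|lebesgue. of_real (?c y - ?c x) * (K x y * u y))"
    unfolding eq by (rule norm_triangle_ineq)
  also have "cmod (of_real (?c x) * (u x + T u x)) = ?c x * cmod (u x + T u x)"
    using cutoff_bounds[of N n x] by (simp add: norm_mult)
  finally have "ennreal (cmod (f x + T f x)) \<le> ennreal (?c x * cmod (u x + T u x))
      + ennreal (cmod (LINT y|lebesgue. of_real (?c y - ?c x) * (K x y * u y)))"
    using cutoff_bounds[of N n x] by (simp add: ennreal_leI flip: ennreal_plus)
  also have "\<dots> \<le> ennreal (?c x * cmod (u x + T u x)) +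
      (\<integral>\<^sup>+y. ennreal (commutator_kernel h N (n - block N y) (x - y)) * ennreal (cmod (u y)) \<partial>lebesgue)"
    using 1 by (rule add_left_mono)
  finally show ?thesis by (simp add: f_def)
qed

lemma measurable_commutator_kernel_pair:
  "(\<lambda>(x, y). ennreal (commutator_kernel h N (n - block N y) (x - y))) \<in> borel_measurable (lebesgue \<Otimes>\<^sub>M lebesgue)"
proof (rule measurable_lebesgue_pair)
  show "(\<lambda>(x, y). ennreal (commutator_kernel h N (n - block N y) (x - y))) \<in> borel_measurable (borel \<Otimes>\<^sub>M borel)"
    unfolding split_beta
    by (rule measurable_compose_countable[where f="\<lambda>m z. ennreal (commutator_kernel h N (n - m) (fst z - snd z))"
        and g="\<lambda>z. block N (snd z)"]) measurable
qed

text \<open>For \<open>y\<close> in block \<open>m\<close> the kernel is a translate of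
  \<open>commutator_kernel h N (n - m)\<close>, so \<open>commutator_mass h N (n - m)\<close> bounds
  its rows and columns there and the block Schur test yields a convolution in
  \<open>n\<close>.\<close>

lemma Lp_le_commutator:
  assumes p: "1 \<le> p" and N: "0 < N" and u [measurable]: "u \<in> borel_measurable lebesgue"
    and A: "\<And>m. 0 < A m" "\<And>m. A m < \<infinity>"
    and le: "\<And>m. Lp_le p (\<lambda>y. indicator {m} (block N y) * ennreal (cmod (u y))) (A m)"
    and R: "conv (commutator_mass h N) A n \<le> R" "0 < R" "R < \<infinity>"
  shows "Lp_le p (\<lambda>x. \<integral>\<^sup>+y. ennreal (commutator_kernel h N (n - block N y) (x - y)) * ennreal (cmod (u y)) \<partial>lebesgue) R"
proof (rule Lp_le_block_schur[OF p, where \<beta>="block N" and s="\<lambda>m. commutator_mass h N (n - m)" and A=A])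
  have ck [measurable]: "(\<lambda>t. ennreal (commutator_kernel h N j t)) \<in> borel_measurable borel" for j
    by measurable
  show "(\<lambda>(x, y). ennreal (commutator_kernel h N (n - block N y) (x - y))) \<in> borel_measurable (lebesgue \<Otimes>\<^sub>M lebesgue)"
    by (rule measurable_commutator_kernel_pair)
  show "(\<integral>\<^sup>+y. indicator {m} (block N y) * ennreal (commutator_kernel h N (n - block N y) (x - y)) \<partial>lebesgue)
      \<le> commutator_mass h N (n - m)" for m x
  proof -
    have "(\<integral>\<^sup>+y. indicator {m} (block N y) * ennreal (commutator_kernel h N (n - block N y) (x - y)) \<partial>lebesgue)
        \<le> (\<integral>\<^sup>+y. ennreal (commutator_kernel h N (n - m) (x - y)) \<partial>lebesgue)"
      by (intro nn_integral_mono) (simp add: indicator_def)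
    then show ?thesis
      using nn_integral_lebesgue_translate(1)[OF ck, of "n - m" x] by (simp add: commutator_mass_def)
  qed
  show "(\<integral>\<^sup>+x. ennreal (commutator_kernel h N (n - block N y) (x - y)) \<partial>lebesgue) \<le> commutator_mass h N (n - block N y)" for y
    using nn_integral_lebesgue_translate(2)[OF ck, of "n - block N y" y] by (simp add: commutator_mass_def)
  show "(\<integral>\<^sup>+m. commutator_mass h N (n - m) * A m \<partial>count_space UNIV) \<le> R"
    using R(1) by (simp add: conv_def)
qed (use A R le in \<open>auto simp: u\<close>)

text \<open>The cutoff is 1 on block \<open>n\<close>, so \<open>A n\<close> is at most the L^p norm
  of the cut-off \<open>u\<close>, to which stability applies. The main term lives on three blocks,
  of measure 3N, and is bounded there by \<open>V\<close>; the commutator accounts for the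
  convolution.\<close>

lemma local_estimate:
  assumes p: "1 \<le> p" and C: "0 < C"
    and stab: "\<And>f. f \<in> Lp p \<Longrightarrow> Lp_norm p f \<le> C * Lp_norm p (\<lambda>x. f x + T f x)"
    and N: "0 < N" and u [measurable]: "u \<in> borel_measurable lebesgue" and M: "\<And>x. cmod (u x) \<le> M" "0 < M"
    and V: "\<And>x. block N x \<in> {n - 1..n + 1} \<Longrightarrow> ennreal (cmod (u x + T u x)) \<le> V" "V < \<infinity>"
    and cm: "mass (commutator_mass h N) < \<infinity>"
  defines "A \<equiv> \<lambda>m. ennreal (Lp_norm p (\<lambda>x. indicator {m} (block N x) * u x))"
  shows "A n \<le> ennreal C * (of_nat (N * 3) * V) + ennreal C * conv (commutator_mass h N) A n"
proof (rule ennreal_le_add_small)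
  define cM where "cM = commutator_mass h N"
  define f where "f = (\<lambda>x. complex_of_real (cutoff N n x) * u x)"
  have c_leb [measurable]: "cutoff N n \<in> borel_measurable lebesgue" by (simp add: measurable_completion)
  have f [measurable]: "f \<in> borel_measurable lebesgue" unfolding f_def by measurable
  have Au: "(\<lambda>x. indicator {m} (block N x) * u x) \<in> borel_measurable lebesgue" for m
    by measurable
  have card3: "card {n - 1..n + 1} = 3" by simp
  have fM: "cmod (f y) \<le> M" for y
  proof -
    have "cmod (f y) \<le> 1 * M"
      unfolding f_def norm_mult using cutoff_bounds[of N n y] M(1)[of y] by (intro mult_mono) auto
    then show ?thesis by simp
  qed
  have fLp: "f \<in> Lp p"
    by (rule Lp_bounded_block(1)[OF p N _ _ M(2) f fM, where J="{n - 1..n + 1}"])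
      (auto simp: f_def cutoff_eq_0)
  have uLp: "(\<lambda>x. indicator {m} (block N x) * u x) \<in> Lp p"
      "Lp_norm p (\<lambda>x. indicator {m} (block N x) * u x) \<le> real N * M" for m
    using Lp_bounded_block[OF p N _ _ M(2) Au, where J="{m}"] M less_imp_le[OF M(2)]
    by (auto simp: indicator_def)
  have Abd: "A m \<le> ennreal (real N * M)" for m
    unfolding A_def by (rule ennreal_leI) (rule uLp(2))
  \<comment> \<open>The total coefficient of \<open>e\<close>: \<open>N * 3\<close> from replacing
    \<open>V\<close> by \<open>V + e\<close>, \<open>mass cM\<close> from replacing \<open>A\<close>
    by \<open>A'\<close>, and 1 from \<open>R\<close>.\<close>
  show "ennreal C * (of_nat (N * 3) + mass cM + 1) < \<infinity>"
    using cm by (simp add: ennreal_mult_less_top cM_def of_nat_less_top ennreal_add_less_top)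
  fix e :: real assume e: "0 < e"
  \<comment> \<open>A block norm may be 0, whereas the weights of the block Schur test must be
    positive.\<close>
  define A' where "A' = (\<lambda>m. A m + ennreal e)"
  define R where "R = conv cM A' n + ennreal e"
  have "conv cM A n \<le> mass cM * ennreal (real N * M)"
    using Abd by (rule conv_le_mass)
  also have "\<dots> < \<infinity>" using cm by (simp add: cM_def ennreal_mult_less_top)
  finally have cA: "conv cM A n < \<infinity>" .
  have cA': "conv cM A' n \<le> conv cM A n + mass cM * ennreal e"
    unfolding A'_def conv_add_right by (intro add_left_mono conv_le_mass) simp
  also have "\<dots> < \<infinity>" using cA cm by (simp add: cM_def ennreal_mult_less_top)
  finally have R: "0 < R" "R < \<infinity>" "conv cM A' n \<le> R"
    using e by (auto simp: R_def add_nonneg_pos)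
  define Q where "Q = of_nat (N * 3) * (V + ennreal e) + R"
  have "Lp_le p (\<lambda>x. ennreal (cutoff N n x * cmod (u x + T u x))) (of_nat (N * 3) * (V + ennreal e))"
  proof (rule Lp_le_bounded_support[OF p, where E="{x. block N x \<in> {n - 1..n + 1}}"])
    show "{x. block N x \<in> {n - 1..n + 1}} \<in> sets lebesgue"
      "emeasure lebesgue {x. block N x \<in> {n - 1..n + 1}} \<le> of_nat (N * 3)"
      using emeasure_block_vimage[OF N, of "{n - 1..n + 1}"] by auto
    have "1 \<le> N * 3" using N by simp
    then show "1 \<le> (of_nat (N * 3) :: ennreal)" by (metis of_nat_1 of_nat_mono)
    show "ennreal (cutoff N n x * cmod (u x + T u x)) \<le> (V + ennreal e) * indicator {x. block N x \<in> {n - 1..n + 1}} x" for x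
    proof (cases "block N x \<in> {n - 1..n + 1}")
      case True
      have "ennreal (cutoff N n x * cmod (u x + T u x)) \<le> ennreal (cmod (u x + T u x))"
        using cutoff_bounds[of N n x] by (intro ennreal_leI mult_left_le_one_le) auto
      also have "\<dots> \<le> V + ennreal e" using V(1)[OF True] by (simp add: add_increasing2)
      finally show ?thesis using True by simp
    qed (simp add: cutoff_eq_0)
  qed (use V e in \<open>auto simp: of_nat_less_top ennreal_mult_less_top add_nonneg_pos\<close>)
  moreover have "Lp_le p (\<lambda>x. \<integral>\<^sup>+y. ennreal (commutator_kernel h N (n - block N y) (x - y)) * ennreal (cmod (u y)) \<partial>lebesgue) R"
  proof (rule Lp_le_commutator[OF p N u _ _ _ _ R(1,2), where A=A'])
    show "0 < A' m" "A' m < \<infinity>" for m using e by (auto simp: A'_def A_def add_nonneg_pos)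
    show "conv (commutator_mass h N) A' n \<le> R" using R(3) by (simp add: cM_def)
    show "Lp_le p (\<lambda>y. indicator {m} (block N y) * ennreal (cmod (u y))) (A' m)" for m
    proof -
      let ?l = "Lp_norm p (\<lambda>x. indicator {m} (block N x) * u x)"
      have l0: "0 \<le> ?l" by (simp add: Lp_norm_def)
      then have "Lp_le p (\<lambda>x. ennreal (cmod (indicator {m} (block N x) * u x))) (ennreal (?l + e))"
        using uLp(1)[of m] e by (subst Lp_le_iff[OF p _ Au]) auto
      then show ?thesis
        by (rule Lp_le_mono) (use l0 e in \<open>auto simp: indicator_def A'_def A_def\<close>)
    qed
  qed
  ultimately have "Lp_le p (\<lambda>x. ennreal (cutoff N n x * cmod (u x + T u x)) +
      (\<integral>\<^sup>+y. ennreal (commutator_kernel h N (n - block N y) (x - y)) * ennreal (cmod (u y)) \<partial>lebesgue)) Q"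
    unfolding Q_def
  proof (intro Lp_le_add[OF p])
    note measurable_commutator_kernel_pair[measurable]
    show "(\<lambda>x. \<integral>\<^sup>+y. ennreal (commutator_kernel h N (n - block N y) (x - y)) * ennreal (cmod (u y)) \<partial>lebesgue) \<in> borel_measurable lebesgue"
      by (rule sigma_finite_measure.borel_measurable_nn_integral[OF sigma_finite_lebesgue]) measurable
  qed (use R N V e in \<open>auto simp: ennreal_zero_less_mult_iff ennreal_mult_less_top of_nat_less_top add_nonneg_pos\<close>)
  then have "Lp_le p (\<lambda>x. ennreal (cmod (f x + T f x))) Q"
    by (rule Lp_le_mono) (use cutoff_commutator_le[OF N u M] in \<open>auto simp: f_def\<close>)
  moreover have "0 < Q" "Q < \<infinity>"
    using R V by (auto simp: Q_def add_nonneg_pos ennreal_mult_less_top of_nat_less_top)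
  then obtain r where r: "Q = ennreal r" "0 < r" by (cases Q) auto
  ultimately have "Lp_norm p (\<lambda>x. f x + T f x) \<le> r"
    by (subst (asm) r, subst (asm) Lp_le_iff[OF p]) auto
  then have "Lp_norm p f \<le> C * r"
    using stab[OF fLp] mult_left_mono[of "Lp_norm p (\<lambda>x. f x + T f x)" r C] C by linarith
  then have "Lp_le p (\<lambda>x. ennreal (cmod (f x))) (ennreal (C * r))"
    using fLp C r by (subst Lp_le_iff[OF p]) auto
  then have "Lp_le p (\<lambda>x. ennreal (cmod (indicator {n} (block N x) * u x))) (ennreal (C * r))"
    by (rule Lp_le_mono) (auto simp: f_def indicator_def cutoff_eq_1)
  then have "Lp_norm p (\<lambda>x. indicator {n} (block N x) * u x) \<le> C * r"
    using C r by (subst (asm) Lp_le_iff[OF p _ Au]) auto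
  then have "A n \<le> ennreal C * Q"
    using C r by (simp add: A_def ennreal_mult[symmetric] ennreal_leI)
  also have "ennreal C * Q \<le> ennreal C *
      (of_nat (N * 3) * (V + ennreal e) + (conv cM A n + mass cM * ennreal e + ennreal e))"
    unfolding Q_def R_def using cA' by (intro mult_left_mono add_left_mono add_right_mono) auto
  also have "\<dots> = ennreal C * (of_nat (N * 3) * V) + ennreal C * conv (commutator_mass h N) A n
      + ennreal e * (ennreal C * (of_nat (N * 3) + mass cM + 1))"
    unfolding cM_def by (simp add: distrib_left distrib_right mult_ac add_ac)
  finally show "A n \<le> ennreal C * (of_nat (N * 3) * V) + ennreal C * conv (commutator_mass h N) A n
      + ennreal e * (ennreal C * (of_nat (N * 3) + mass cM + 1))" .
qed

section \<open>Pointwise domination of \<open>T f\<close> by block integrals of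
  \<open>f + T f\<close>\<close>

lemma op_id_plus_op:
  assumes q: "1 \<le> q" and f: "f \<in> Lp q" and u: "\<And>x. cmod (T f x) \<le> M" "0 < M"
  shows "T (\<lambda>y. f y + T f y) x = T f x + T (T f) x"
proof -
  have [measurable]: "f \<in> borel_measurable lebesgue" using f by (simp add: Lp_def)
  have "integrable lebesgue (\<lambda>y. K x y * T f y)"
    by (rule integrable_K_bounded[OF _ u]) measurable
  then have "(LINT y|lebesgue. K x y * f y + K x y * T f y) = T f x + T (T f) x"
    unfolding integral_op_def[of K f x] integral_op_def[of K "T f" x]
    using integrable_K_Lp[OF q f, of x] by (intro Bochner_Integration.integral_add)
  then show ?thesis by (simp add: integral_op_def[of K "\<lambda>y. f y + T f y"] distrib_left)
qed

lemma exists_small_commutator_mass: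
  assumes "0 < (C :: real)"
  obtains N where "0 < N" "ennreal C * mass (commutator_mass h N) \<le> 1 / 2"
proof -
  have "(\<integral>\<^sup>+t. ennreal \<bar>h t\<bar> \<partial>lebesgue) < \<infinity>"
    using nn_integral_le_wiener_norm[OF measurable_h] h_fin by (rule le_less_trans)
  from tail_kernel_tendsto[OF measurable_h this]
  \<comment> \<open>The threshold solves 12 * C * x = 1/2, with 12 from
    \<open>mass_commutator_mass\<close>.\<close>
  have "eventually (\<lambda>N. (\<integral>\<^sup>+t. ennreal (tail_kernel h N t) \<partial>lebesgue) < ennreal (1 / (24 * C))) sequentially"
    by (rule order_tendstoD) (use assms in simp)
  then have "eventually (\<lambda>N. 0 < N \<and> (\<integral>\<^sup>+t. ennreal (tail_kernel h N t) \<partial>lebesgue) < ennreal (1 / (24 * C))) sequentially"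
    using eventually_gt_at_top[of 0] by eventually_elim simp
  then obtain N where N: "0 < N" "(\<integral>\<^sup>+t. ennreal (tail_kernel h N t) \<partial>lebesgue) < ennreal (1 / (24 * C))"
    by (auto dest: eventually_happens)
  have "ennreal C * mass (commutator_mass h N) \<le> ennreal C * (12 * ennreal (1 / (24 * C)))"
    using mass_commutator_mass[OF measurable_h, of N] less_imp_le[OF N(2)]
    by (intro mult_left_mono) (auto elim!: order_trans intro: mult_left_mono)
  also have "\<dots> = ennreal C * (ennreal 12 * ennreal (1 / (24 * C)))" by simp
  also have "\<dots> = ennreal (C * (12 * (1 / (24 * C))))"
    using assms by (subst ennreal_mult, simp, simp, subst ennreal_mult, simp_all)
  also have "\<dots> = ennreal (1 / 2)" using assms by simp
  also have "\<dots> = 1 / 2" by (simp add: divide_ennreal_def)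
  finally show ?thesis using N(1) by (rule that[rotated])
qed

text \<open>The order of quantifiers is the point: \<open>N\<close> and \<open>W\<close> are built
  from \<open>h\<close> and \<open>C\<close> before \<open>q\<close> and \<open>f\<close> appear.
  Stability at \<open>p\<close> enters only through \<open>C\<close>, and the conclusion mentions no
  exponent besides the one that makes \<open>f\<close> admissible.\<close>

lemma op_le_conv_id_plus_op:
  assumes p: "1 \<le> p" and C: "0 < C"
    and stab: "\<And>f. f \<in> Lp p \<Longrightarrow> Lp_norm p f \<le> C * Lp_norm p (\<lambda>x. f x + T f x)"
  obtains N W where "0 < N" "mass W < \<infinity>"
    "\<And>q f x. 1 \<le> q \<Longrightarrow> f \<in> Lp q \<Longrightarrow>
      ennreal (cmod (T f x)) \<le> conv W (block_integral N (\<lambda>y. ennreal (cmod (f y + T f y)))) (block N x)"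
proof -
  obtain N where N: "0 < N" and small: "ennreal C * mass (commutator_mass h N) \<le> 1 / 2"
    using exists_small_commutator_mass[OF C] by blast
  define t where "t = (\<lambda>j. ennreal C * commutator_mass h N j)"
  have t: "mass t \<le> 1 / 2" using small by (simp add: t_def mass_cmult)
  have cm: "mass (commutator_mass h N) < \<infinity>"
  proof (rule ccontr)
    assume "\<not> ?thesis"
    then have "mass (commutator_mass h N) = top" by (simp add: less_top[symmetric])
    with small C show False by (simp add: ennreal_mult_top top_unique divide_ennreal_def)
  qed
  define H where "H = block_sup h N"
  have H: "mass H < \<infinity>" unfolding H_def by (rule mass_block_sup[OF N h_fin])
  \<comment> \<open>Dominates \<open>H\<close> for all three blocks that meet the support of the
    cutoff around block \<open>n\<close>.\<close>
  define H3 where "H3 = (\<lambda>j. H (j - 1) + H j + H (j + 1))"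
  have H3: "mass H3 < \<infinity>"
  proof -
    have "mass (\<lambda>j. H (j - 1)) = mass H" "mass (\<lambda>j. H (j + 1)) = mass H"
      unfolding mass_def by (rule nn_integral_int_shift)+
    then show ?thesis using H by (simp add: H3_def mass_add ennreal_add_less_top)
  qed
  define w where "w = neumann t"
  have w: "mass w < \<infinity>"
    using mass_neumann[OF t] by (simp add: w_def) (meson ennreal_numeral_less_top le_less_trans)
  \<comment> \<open>The outer \<open>N\<close> turns L^p block norms into L^1 block integrals,
    \<open>C\<close> is the stability constant, and \<open>N * 3\<close> is the measure of the
    cutoff's three blocks.\<close>
  define D where "D = of_nat N * (ennreal C * of_nat (N * 3))"
  define W where "W = (\<lambda>j. H j + D * conv H (conv w H3) j)"
  have "mass W < \<infinity>"
    using H H3 w by (simp add: W_def mass_add mass_cmult mass_conv D_def ennreal_mult_less_top of_nat_less_top ennreal_add_less_top)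
  moreover have "ennreal (cmod (T f x)) \<le> conv W (block_integral N (\<lambda>y. ennreal (cmod (f y + T f y)))) (block N x)"
    if q: "1 \<le> q" and f: "f \<in> Lp q" for q f x
  proof -
    define u where "u = T f"
    define g where "g = (\<lambda>y. f y + u y)"
    define Lg where "Lg = block_integral N (\<lambda>y. ennreal (cmod (g y)))"
    define Lu where "Lu = block_integral N (\<lambda>y. ennreal (cmod (u y)))"
    obtain c where c: "0 < c" "Lp_le q (\<lambda>y. ennreal (cmod (f y))) (ennreal c)" and f_m [measurable]: "f \<in> borel_measurable lebesgue"
      using Lp_exists_Lp_le[OF q f] by blast
    have u_m [measurable]: "u \<in> borel_measurable lebesgue" unfolding u_def by measurable
    have g_m [measurable]: "g \<in> borel_measurable lebesgue" unfolding g_def by measurable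
    have "g \<in> Lp q"
      using bounded_id_plus_op(1)[OF q] f by (simp add: bounded_op_Lp_def g_def u_def)
    then obtain c' where c': "0 < c'" "Lp_le q (\<lambda>y. ennreal (cmod (g y))) (ennreal c')"
      using Lp_exists_Lp_le[OF q] by blast
    have Lg_le: "Lg m \<le> of_nat N * ennreal c'" for m
      unfolding Lg_def using c' by (intro block_integral_le_Lp_le[OF q N _ _ g_m]) auto
    \<comment> \<open>This bound depends on \<open>f\<close>. It puts the pieces of \<open>u\<close>
      into L^p and bounds \<open>A\<close> a priori, and it does not reach \<open>W\<close>.\<close>
    define M where "M = enn2real (mass H * (of_nat N * ennreal c)) + 1"
    have M: "0 < M" "cmod (u y) \<le> M" for y
    proof -
      show "0 < M" by (simp add: M_def add_nonneg_pos)
      have "ennreal (cmod (u y)) \<le> conv H (block_integral N (\<lambda>y. ennreal (cmod (f y)))) (block N y)"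
        unfolding u_def H_def by (rule op_le_conv[OF f_m N])
      also have "\<dots> \<le> mass H * (of_nat N * ennreal c)"
        using c by (intro conv_le_mass block_integral_le_Lp_le[OF q N _ _ f_m]) auto
      also have "\<dots> = ennreal (enn2real (mass H * (of_nat N * ennreal c)))"
        using H by (simp add: ennreal_mult_less_top of_nat_less_top)
      also have "\<dots> \<le> ennreal M" by (intro ennreal_leI) (simp add: M_def)
      finally show "cmod (u y) \<le> M" using \<open>0 < M\<close> by simp
    qed
    have v: "u y + T u y = T g y" for y
      using op_id_plus_op[OF q f, of M y] M by (simp add: u_def g_def)
    define V where "V = conv H3 Lg"
    have V: "ennreal (cmod (u y + T u y)) \<le> V n" if J: "block N y \<in> {n - 1..n + 1}" for y n
    proof -
      have "ennreal (cmod (u y + T u y)) \<le> conv H Lg (block N y)"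
        unfolding v H_def Lg_def by (rule op_le_conv[OF g_m N])
      also have "\<dots> \<le> V n"
        unfolding V_def conv_def
      proof (intro nn_integral_mono mult_right_mono)
        fix m
        consider "block N y = n - 1" | "block N y = n" | "block N y = n + 1"
          using J by force
        then show "H (block N y - m) \<le> H3 (n - m)"
          by cases (auto simp: H3_def algebra_simps add_increasing add_increasing2)
      qed simp
      finally show ?thesis .
    qed
    have V_fin: "V n < \<infinity>" for n
    proof -
      have "V n \<le> mass H3 * (of_nat N * ennreal c')"
        unfolding V_def using Lg_le by (rule conv_le_mass)
      also have "\<dots> < \<infinity>" using H3 by (simp add: ennreal_mult_less_top of_nat_less_top)
      finally show ?thesis .
    qed
    define A where "A = (\<lambda>m. ennreal (Lp_norm p (\<lambda>x. indicator {m} (block N x) * u x)))"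
    have Au: "(\<lambda>x. indicator {m} (block N x) * u x) \<in> borel_measurable lebesgue" for m
      by measurable
    have uLp: "(\<lambda>x. indicator {m} (block N x) * u x) \<in> Lp p"
        "Lp_norm p (\<lambda>x. indicator {m} (block N x) * u x) \<le> real N * M" for m
      using Lp_bounded_block[OF p N _ _ M(1) Au, where J="{m}"] M(2) less_imp_le[OF M(1)]
      by (auto simp: indicator_def)
    have "A n \<le> ennreal C * (of_nat (N * 3) * V n) + conv t A n" for n
      using local_estimate[OF p C stab N u_m M(2,1) V V_fin cm, of n]
      by (simp add: A_def t_def conv_cmult_left)
    moreover have "A n \<le> ennreal (real N * M)" for n
      unfolding A_def by (rule ennreal_leI) (rule uLp(2))
    \<comment> \<open>The term \<open>conv t A n\<close> is absorbed here; this is what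
      \<open>N\<close> was chosen for.\<close>
    ultimately have A: "A n \<le> conv w (\<lambda>n. ennreal C * (of_nat (N * 3) * V n)) n" for n
      unfolding w_def by (intro le_conv_neumann[OF t, where M="ennreal (real N * M)"]) auto
    have Lu: "Lu n \<le> of_nat N * A n" for n
    proof (rule ennreal_le_add_small)
      fix e :: real assume e: "0 < e"
      let ?l = "Lp_norm p (\<lambda>x. indicator {n} (block N x) * u x)"
      have l0: "0 \<le> ?l" by (simp add: Lp_norm_def)
      then have "Lp_le p (\<lambda>x. ennreal (cmod (indicator {n} (block N x) * u x))) (ennreal (?l + e))"
        using uLp(1)[of n] e by (subst Lp_le_iff[OF p _ Au]) auto
      then have "Lp_le p (\<lambda>x. indicator {n} (block N x) * ennreal (cmod (u x))) (A n + ennreal e)"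
        by (rule Lp_le_mono) (use l0 e in \<open>auto simp: indicator_def A_def\<close>)
      then have "Lu n \<le> of_nat N * (A n + ennreal e)"
        unfolding Lu_def using e by (intro block_integral_le[OF p N]) (auto simp: A_def add_nonneg_pos)
      then show "Lu n \<le> of_nat N * A n + ennreal e * of_nat N" by (simp add: distrib_left mult.commute)
    qed (simp add: of_nat_less_top)
    have "conv H Lu (block N x) \<le> conv H (\<lambda>n. of_nat N * conv w (\<lambda>n. ennreal C * (of_nat (N * 3) * V n)) n) (block N x)"
      by (intro conv_mono order_refl order_trans[OF Lu] mult_left_mono A) simp
    also have "\<dots> = D * conv (conv H (conv w H3)) Lg (block N x)"
      by (simp add: conv_cmult_right D_def V_def conv_assoc[abs_def] mult.assoc)
    finally have 1: "conv H Lu (block N x) \<le> D * conv (conv H (conv w H3)) Lg (block N x)" .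
    \<comment> \<open>From \<open>u = T g - T u\<close>: the first term contributes \<open>H\<close>
      to \<open>W\<close>. For the second, the block integrals of \<open>u\<close> have just been
      bounded by those of \<open>g\<close>.\<close>
    have "cmod (u x) \<le> cmod (T g x) + cmod (T u x)"
      using norm_triangle_ineq4[of "T g x" "T u x"] by (simp flip: v)
    then have "ennreal (cmod (u x)) \<le> ennreal (cmod (T g x)) + ennreal (cmod (T u x))"
      by (simp add: ennreal_leI flip: ennreal_plus)
    also have "\<dots> \<le> conv H Lg (block N x) + conv H Lu (block N x)"
      unfolding H_def Lg_def Lu_def by (intro add_mono op_le_conv N g_m u_m)
    also have "\<dots> \<le> conv H Lg (block N x) + D * conv (conv H (conv w H3)) Lg (block N x)"
      using 1 by (rule add_left_mono)
    also have "\<dots> = conv W Lg (block N x)"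
      by (simp add: W_def conv_add_left conv_cmult_left)
    finally show ?thesis by (simp add: u_def g_def Lg_def)
  qed
  ultimately show ?thesis by (rule that[OF N])
qed

text \<open>The kernel \<open>W (block N x - block N y)\<close> depends only on the difference of
  block indices, so all rows and columns have the integral \<open>N * mass W\<close>.\<close>

lemma Lp_le_conv_block:
  assumes q: "1 \<le> q" and N: "0 < N" and W: "mass W < \<infinity>" and c: "0 < c" "c < \<infinity>"
    and F [measurable]: "F \<in> borel_measurable lebesgue" and le: "Lp_le q F c"
  shows "Lp_le q (\<lambda>x. conv W (block_integral N F) (block N x)) ((of_nat N * mass W + 1) * c)"
  unfolding conv_block_integral_eq[OF F]
proof (rule Lp_le_schur[OF q _ F c _ _ _ _ le])
  have "(\<lambda>z. W (block N (fst z) - block N (snd z))) \<in> borel_measurable (borel \<Otimes>\<^sub>M borel)"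
  proof (rule measurable_compose_countable[where g="\<lambda>z. block N (fst z)"])
    show "(\<lambda>z. W (m - block N (snd z))) \<in> borel_measurable (borel \<Otimes>\<^sub>M borel)" for m
      by (rule measurable_compose_countable[where g="\<lambda>z. block N (snd z)"]) measurable
  qed measurable
  then show "(\<lambda>(x, y). W (block N x - block N y)) \<in> borel_measurable (lebesgue \<Otimes>\<^sub>M lebesgue)"
    by (intro measurable_lebesgue_pair) (simp add: split_beta)
  show "0 < of_nat N * mass W + 1" "of_nat N * mass W + 1 < \<infinity>"
    using W by (auto simp: add_nonneg_pos ennreal_mult_less_top of_nat_less_top)
  show "(\<integral>\<^sup>+y. W (block N x - block N y) \<partial>lebesgue) \<le> of_nat N * mass W + 1" for x
    by (simp add: nn_integral_mass_block(1)[OF N])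
  show "(\<integral>\<^sup>+x. W (block N x - block N y) \<partial>lebesgue) \<le> of_nat N * mass W + 1" for y
    by (simp add: nn_integral_mass_block(2)[OF N])
qed

lemma Lp_stability_transfer:
  assumes p: "1 \<le> p" and stab: "Lp_stability p (\<lambda>f x. f x + T f x)" and q: "1 \<le> q"
  shows "Lp_stability q (\<lambda>f x. f x + T f x)"
proof -
  obtain C where C: "0 < C" "\<And>f. f \<in> Lp p \<Longrightarrow> inverse C * Lp_norm p f \<le> Lp_norm p (\<lambda>x. f x + T f x)"
    using stab by (auto simp: Lp_stability_def)
  have "Lp_norm p f \<le> C * Lp_norm p (\<lambda>x. f x + T f x)" if "f \<in> Lp p" for f
    using C(2)[OF that] C(1) by (simp add: field_simps)
  from op_le_conv_id_plus_op[OF p C(1) this] obtain N W where N: "0 < N" and W: "mass W < \<infinity>" and le: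
    "\<And>q f x. 1 \<le> q \<Longrightarrow> f \<in> Lp q \<Longrightarrow>
      ennreal (cmod (T f x)) \<le> conv W (block_integral N (\<lambda>y. ennreal (cmod (f y + T f y)))) (block N x)"
    by blast
  \<comment> \<open>One unit comes from \<open>g\<close> in \<open>f = g - T f\<close>, the other
    keeps the Schur constant \<open>N * mass W + 1\<close> positive.\<close>
  define S where "S = enn2real (of_nat N * mass W) + 2"
  have S: "0 < S" by (simp add: S_def add_nonneg_pos)
  have inverse_bound: "Lp_norm q f \<le> S * Lp_norm q (\<lambda>x. f x + T f x)" if f: "f \<in> Lp q" for f
  proof (rule le_mult_if_forall_gt[OF S])
    fix c assume c: "Lp_norm q (\<lambda>x. f x + T f x) < c"
    define g where "g = (\<lambda>x. f x + T f x)"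
    have [measurable]: "f \<in> borel_measurable lebesgue" using f by (simp add: Lp_def)
    have g [measurable]: "g \<in> borel_measurable lebesgue" unfolding g_def by measurable
    have "0 \<le> Lp_norm q g" by (simp add: Lp_norm_def)
    then have c0: "0 < c" using c by (simp add: g_def)
    have "g \<in> Lp q"
      using bounded_id_plus_op(1)[OF q] f by (simp add: bounded_op_Lp_def g_def)
    then have Lg: "Lp_le q (\<lambda>x. ennreal (cmod (g x))) (ennreal c)"
      using c c0 by (subst Lp_le_iff[OF q]) (auto simp: g_def)
    let ?S' = "of_nat N * mass W + 1"
    have S': "0 < ?S' * ennreal c" "?S' * ennreal c < \<infinity>"
      using W c0 by (auto simp: ennreal_zero_less_mult_iff ennreal_mult_less_top of_nat_less_top add_nonneg_pos)
    have "Lp_le q (\<lambda>x. conv W (block_integral N (\<lambda>y. ennreal (cmod (g y)))) (block N x)) (?S' * ennreal c)"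
      using c0 by (intro Lp_le_conv_block[OF q N W _ _ _ Lg]) auto
    then have "Lp_le q (\<lambda>x. ennreal (cmod (T f x))) (?S' * ennreal c)"
      by (rule Lp_le_mono) (use le[OF q f] in \<open>auto simp: g_def\<close>)
    then have "Lp_le q (\<lambda>x. ennreal (cmod (g x)) + ennreal (cmod (T f x))) (ennreal c + ?S' * ennreal c)"
      using c0 S' by (intro Lp_le_add[OF q _ _ _ _ _ _ Lg]) auto
    then have "Lp_le q (\<lambda>x. ennreal (cmod (f x))) (ennreal (S * c))"
    proof (rule Lp_le_mono)
      show "ennreal (cmod (f x)) \<le> ennreal (cmod (g x)) + ennreal (cmod (T f x))" for x
        using norm_triangle_ineq4[of "g x" "T f x"] by (simp add: g_def ennreal_leI flip: ennreal_plus)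
      obtain r where r: "of_nat N * mass W = ennreal r" "0 \<le> r"
        using W by (cases "of_nat N * mass W") (auto simp: ennreal_mult_eq_top_iff)
      have "?S' * ennreal c = ennreal ((r + 1) * c)"
        unfolding r using r c0 by (simp add: ennreal_mult' ennreal_plus)
      then have "ennreal c + ?S' * ennreal c = ennreal ((r + 2) * c)"
        using r c0 by (simp add: ennreal_plus[symmetric] algebra_simps del: ennreal_plus)
      then show "ennreal c + ?S' * ennreal c \<le> ennreal (S * c)"
        using r by (simp add: S_def)
    qed
    then show "Lp_norm q f \<le> S * c"
      using S c0 by (subst (asm) Lp_le_iff[OF q]) auto
  qed
  let ?B = "2 + enn2real (wiener_norm h)"
  have B: "0 < ?B" by (simp add: add_pos_nonneg)
  have "\<exists>C>0. \<forall>f\<in>Lp q. inverse C * Lp_norm q f \<le> Lp_norm q (\<lambda>x. f x + T f x) \<and>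
      Lp_norm q (\<lambda>x. f x + T f x) \<le> C * Lp_norm q f"
  \<comment> \<open>Stability asks for a single constant: \<open>?B\<close> serves the upper bound
    and \<open>S\<close> the lower one.\<close>
  proof (intro exI[of _ "max ?B S"] conjI ballI)
    show "0 < max ?B S" using S by simp
    fix f assume f: "f \<in> Lp q"
    have nn: "0 \<le> Lp_norm q f" "0 \<le> Lp_norm q (\<lambda>x. f x + T f x)" by (simp_all add: Lp_norm_def)
    show "Lp_norm q (\<lambda>x. f x + T f x) \<le> max ?B S * Lp_norm q f"
      using bounded_id_plus_op(2)[OF q f] mult_right_mono[of ?B "max ?B S" "Lp_norm q f"] nn by simp
    have "Lp_norm q f \<le> max ?B S * Lp_norm q (\<lambda>x. f x + T f x)"
      using inverse_bound[OF f] mult_right_mono[of S "max ?B S" "Lp_norm q (\<lambda>x. f x + T f x)"] nn by simp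
    then show "inverse (max ?B S) * Lp_norm q f \<le> Lp_norm q (\<lambda>x. f x + T f x)"
      using \<open>0 < max ?B S\<close> by (simp add: field_simps)
  qed
  then show ?thesis
    using bounded_id_plus_op(1)[OF q] by (simp add: Lp_stability_def)
qed

end

section \<open>Joint continuity of the kernel and conclusion\<close>

lemma continuous_kernel_if_modulus_cont:
  fixes K :: "real \<Rightarrow> real \<Rightarrow> complex"
  assumes "0 < \<alpha>" and mod: "\<And>x y \<delta>. 0 < \<delta> \<Longrightarrow> \<delta> < 1 \<Longrightarrow> \<bar>modulus_cont \<delta> K x y\<bar> \<le> ereal (\<delta> powr \<alpha> * h (x - y))"
  shows "continuous_on UNIV (\<lambda>(x, y). K x y)"
  unfolding continuous_on_iff
proof (intro ballI allI impI)
  fix z :: "real \<times> real" and e :: real assume e: "0 < e"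
  obtain x y where z: "z = (x, y)" by fastforce
  have "eventually ((\<le>) (0::real)) (at_right 0)"
    unfolding eventually_at_right_field by (intro exI[of _ 1]) auto
  \<comment> \<open>At a fixed point (x, y) the factor \<open>h (x - y)\<close> is a constant, so
    the bound on the modulus tends to 0 with \<open>\<delta>\<close>; some \<open>\<delta>\<close>
    in (0,1) then serves the given \<open>e\<close>.\<close>
  then have "((\<lambda>\<delta>. \<delta> powr \<alpha> * h (x - y)) \<longlongrightarrow> 0 powr \<alpha> * h (x - y)) (at_right 0)"
    using assms(1) by (intro tendsto_mult tendsto_powr' tendsto_const tendsto_ident_at) auto
  then have "eventually (\<lambda>\<delta>. \<delta> powr \<alpha> * h (x - y) < e) (at_right 0)"
    using e by (intro order_tendstoD(2)[where y="0 powr \<alpha> * h (x - y)"]) auto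
  moreover have "eventually (\<lambda>\<delta>::real. 0 < \<delta> \<and> \<delta> < 1) (at_right 0)"
    unfolding eventually_at_right_field by (intro exI[of _ 1]) auto
  ultimately have "eventually (\<lambda>\<delta>. 0 < \<delta> \<and> \<delta> < 1 \<and> \<delta> powr \<alpha> * h (x - y) < e) (at_right 0)"
    by eventually_elim simp
  then obtain \<delta> where \<delta>: "0 < \<delta>" "\<delta> < 1" "\<delta> powr \<alpha> * h (x - y) < e"
    using eventually_happens[of _ "at_right (0::real)"] by (auto simp: trivial_limit_at_right_real)
  show "\<exists>d>0. \<forall>z'\<in>UNIV. dist z' z < d \<longrightarrow> dist (case z' of (x, y) \<Rightarrow> K x y) (case z of (x, y) \<Rightarrow> K x y) < e"
  proof (intro exI[of _ \<delta>] conjI ballI impI \<delta>(1))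
    fix z' assume d: "dist z' z < \<delta>"
    define w where "w = z' - z"
    have w: "w \<in> {z. norm z \<le> \<delta>}" using d by (simp add: w_def dist_norm)
    obtain a b where ab: "w = (a, b)" by fastforce
    have "ereal (cmod (K (x + a) (y + b) - K x y)) \<le> modulus_cont \<delta> K x y"
      unfolding modulus_cont_def using SUP_upper[OF w, of "\<lambda>(x', y'). ereal (cmod (K (x + x') (y + y') - K x y))"]
      by (simp add: ab)
    also have "\<dots> \<le> \<bar>modulus_cont \<delta> K x y\<bar>"
      by (cases "modulus_cont \<delta> K x y") auto
    also have "\<dots> \<le> ereal (\<delta> powr \<alpha> * h (x - y))"
      by (rule mod[OF \<delta>(1,2)])
    finally have "cmod (K (x + a) (y + b) - K x y) < e" using \<delta>(3) by simp
    moreover have "z' = (x + a, y + b)" using ab by (simp add: w_def z) (metis add.commute diff_add_cancel add_Pair)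
    ultimately show "dist (case z' of (x, y) \<Rightarrow> K x y) (case z of (x, y) \<Rightarrow> K x y) < e"
      by (simp add: z dist_norm)
  qed
qed

theorem theorem1p4:
  fixes \<alpha> :: real and h :: "real \<Rightarrow> real" and K :: "real \<Rightarrow> real \<Rightarrow> complex" and p :: ennreal
  assumes "0 < \<alpha>" and "\<alpha> < 1"
    and "continuous_on UNIV h" and "h \<in> wiener_amalgam"
    and "\<And>x y. cmod (K x y) \<le> h (x - y)"
    and "\<And>x y \<delta>. 0 < \<delta> \<Longrightarrow> \<delta> < 1 \<Longrightarrow>
           \<bar>modulus_cont \<delta> K x y\<bar> \<le> ereal (\<delta> powr \<alpha> * h (x - y))"
    and "1 \<le> p"
    and "Lp_stability p (\<lambda>f x. f x + integral_op K f x)"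
  shows "\<forall>q::ennreal. 1 \<le> q \<longrightarrow> Lp_stability q (\<lambda>f x. f x + integral_op K f x)"
proof -
  have "(\<lambda>(x, y). K x y) \<in> borel_measurable borel"
    using assms(1,6) by (intro borel_measurable_continuous_onI continuous_kernel_if_modulus_cont)
  moreover have "h \<in> borel_measurable borel"
    using assms(3) by (rule borel_measurable_continuous_onI)
  ultimately interpret wiener_kernel K h
    using assms(4,5) by unfold_locales (auto simp: borel_prod wiener_amalgam_def)
  show ?thesis
    using Lp_stability_transfer[OF assms(7,8)] by blast
qed

end
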